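(* For every fixed even integer $k\ge 4$ there is a constant $C_k$ such that, for every positive integer $N$, the interval $[N]$ admits a coloring with at most $C_kN^{4/k^2}$ colors and no nontrivial symmetrically colored $k$-term arithmetic progression. More precisely, for every fixed even integer $k\ge4$ and all sufficiently large $N$ (depending on $k$), at most $2(k-1)^{k^2/4-1}N^{4/k^2}$ colors suffice.
   Context: Here $[N]=\{1,\ldots,N\}$. A $k$-term arithmetic progression in $[N]$ is a sequence $a,a+d,\ldots,a+(k-1)d$ of integers, all lying in $[N]$; it is nontrivial if $d\ne 0$. Given a coloring $c$ of $[N]$ and $k$ even, it is symmetrically colored if $c(a+(i-1)d)=c(a+(k-i)d)$ for every $i\in\{1,\ldots,k/2\}$. *)

theory Defs
  imports Complex_Main
begin

(* The progression with first term a and difference d (of either sign) has the terms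
   a + i * d for 0 <= i < k. *)
definition ap_in_interval :: "nat \<Rightarrow> nat \<Rightarrow> int \<Rightarrow> int \<Rightarrow> bool" where
  "ap_in_interval N k a d \<longleftrightarrow> (\<forall>i<k. a + int i * d \<in> {1..int N})"

definition symmetrically_colored :: "(int \<Rightarrow> 'c) \<Rightarrow> nat \<Rightarrow> int \<Rightarrow> int \<Rightarrow> bool" where
  "symmetrically_colored c k a d \<longleftrightarrow>
     (\<forall>i\<in>{1..k div 2}. c (a + (int i - 1) * d) = c (a + (int k - int i) * d))"

(* A coloring of [N] is a function on all integers of which only the values on {1..int N}
   matter; its number of colors is card (c ` {1..int N}). *)
definition no_symmetric_ap :: "(int \<Rightarrow> 'c) \<Rightarrow> nat \<Rightarrow> nat \<Rightarrow> bool" where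
  "no_symmetric_ap c N k \<longleftrightarrow>
     \<not> (\<exists>a d. d \<noteq> 0 \<and> ap_in_interval N k a d \<and> symmetrically_colored c k a d)"

end

theory Submission
  imports Defs "HOL-Computational_Algebra.Computational_Algebra" "HOL-Library.Countable"
    "HOL-Real_Asymp.Real_Asymp"
begin

text \<open>
  Let \<open>m = k\<^sup>2 / 4 = 1 + 3 + \<dots> + (k - 1)\<close> and let \<open>p\<close> be a prime with \<open>N < p ^ m\<close>. An integer is written
  in base \<open>p\<close>, its \<open>m\<close> digits are split into blocks of the odd lengths \<open>j = 1, 3, \<dots>, k - 1\<close>, and the
  color records the sum modulo \<open>p\<close> of the norm forms of the fields with \<open>p ^ j\<close> elements, evaluated
  at the blocks, together with the third of \<open>[0, p)\<close> that contains each digit but the leading one.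
  The thirds ensure that the digits of a symmetrically colored progression are themselves arithmetic
  progressions. Along such a progression the sum is a polynomial \<open>F\<close> of degree less than \<open>k\<close> in the
  index, with \<open>F(i) = F(k - 1 - i)\<close> modulo \<open>p\<close>. If \<open>F\<close> had odd degree \<open>n\<close>, then taking \<open>n\<close>-th
  differences would annihilate its leading coefficient, the value of a norm form at the digit
  differences. Norm forms are anisotropic, so these differences vanish block by block.
\<close>

section \<open>Ideals of characteristic \<open>p\<close>\<close>

text \<open>Residue rings are never formed: a type cannot depend on \<open>p\<close> and
  \<open>j\<close>, so congruence is written as membership of a difference.\<close>

locale ring_ideal =
  fixes I :: "'a::comm_ring_1 set"
  assumes zero: "0 \<in> I"
    and add: "x \<in> I \<Longrightarrow> y \<in> I \<Longrightarrow> x + y \<in> I"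
    and mult_left: "x \<in> I \<Longrightarrow> r * x \<in> I"
begin

lemma mult_right: "x \<in> I \<Longrightarrow> x * r \<in> I"
  using mult_left[of x r] by (simp add: mult.commute)

lemma uminus: "x \<in> I \<Longrightarrow> - x \<in> I"
  using mult_left[of x "-1"] by simp

lemma diff: "x \<in> I \<Longrightarrow> y \<in> I \<Longrightarrow> x - y \<in> I"
  using add[of x "- y"] uminus[of y] by simp

lemma mem_power: "x \<in> I \<Longrightarrow> n > 0 \<Longrightarrow> x ^ n \<in> I"
  by (cases n) (auto intro: mult_right)

lemma sum: "(\<And>i. i \<in> A \<Longrightarrow> f i \<in> I) \<Longrightarrow> sum f A \<in> I"
  by (induction A rule: infinite_finite_induct) (auto intro: zero add)

lemma cong_trans: "x - y \<in> I \<Longrightarrow> y - z \<in> I \<Longrightarrow> x - z \<in> I"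
  using add[of "x - y" "y - z"] by simp

lemma cong_sym: "x - y \<in> I \<Longrightarrow> y - x \<in> I"
  using uminus[of "x - y"] by simp

lemma cong_mem: "x - y \<in> I \<Longrightarrow> x \<in> I \<longleftrightarrow> y \<in> I"
  using add[of "x - y" y] diff[of x "x - y"] by auto

lemma cong_add: "x - y \<in> I \<Longrightarrow> x' - y' \<in> I \<Longrightarrow> (x + x') - (y + y') \<in> I"
  using add[of "x - y" "x' - y'"] by (simp add: algebra_simps)

lemma cong_mult:
  assumes "x - y \<in> I" "x' - y' \<in> I"
  shows "x * x' - y * y' \<in> I"
proof -
  have "x * x' - y * y' = (x - y) * x' + y * (x' - y')"
    by (simp add: algebra_simps)
  then show ?thesis
    using assms by (simp add: add mult_left mult_right)
qed

lemma cong_power: "x - y \<in> I \<Longrightarrow> x ^ n - y ^ n \<in> I"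
  by (induction n) (auto intro: zero cong_mult)

lemma cong_sum: "(\<And>i. i \<in> A \<Longrightarrow> f i - g i \<in> I) \<Longrightarrow> sum f A - sum g A \<in> I"
  by (simp add: sum sum_subtractf[symmetric])

lemma cong_prod: "(\<And>i. i \<in> A \<Longrightarrow> f i - g i \<in> I) \<Longrightarrow> prod f A - prod g A \<in> I"
  by (induction A rule: infinite_finite_induct) (auto intro: zero cong_mult)

lemma frobenius_add:
  assumes "prime p" "of_nat p \<in> I"
  shows "(x + y) ^ p - (x ^ p + y ^ p) \<in> I"
proof -
  have p: "p > 0" using assms(1) prime_gt_0_nat by blast
  have "(x + y) ^ p = (\<Sum>k\<le>p. of_nat (p choose k) * x ^ k * y ^ (p - k))"
    by (rule binomial_ring)
  also have "{..p} = insert 0 (insert p {1..<p})"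
    using p by auto
  also have "(\<Sum>k\<in>\<dots>. of_nat (p choose k) * x ^ k * y ^ (p - k)) =
      y ^ p + x ^ p + (\<Sum>k=1..<p. of_nat (p choose k) * x ^ k * y ^ (p - k))"
    using p by simp
  finally have "(x + y) ^ p - (x ^ p + y ^ p) = (\<Sum>k=1..<p. of_nat (p choose k) * x ^ k * y ^ (p - k))"
    by simp
  also have "\<dots> \<in> I"
  proof (rule sum)
    fix k assume "k \<in> {1..<p}"
    then have "p dvd p choose k"
      using assms(1) by (intro dvd_choose_prime) auto
    then obtain c where "p choose k = p * c" ..
    then show "of_nat (p choose k) * x ^ k * y ^ (p - k) \<in> I"
      using assms(2) by (simp add: mult_right)
  qed
  finally show ?thesis .
qed

lemma frobenius_power_add:
  assumes "prime p" "of_nat p \<in> I"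
  shows "(x + y) ^ (p ^ d) - (x ^ (p ^ d) + y ^ (p ^ d)) \<in> I"
proof (induction d)
  case 0
  then show ?case by (simp add: zero)
next
  case (Suc d)
  have "((x + y) ^ (p ^ d)) ^ p - (x ^ (p ^ d) + y ^ (p ^ d)) ^ p \<in> I"
    by (rule cong_power[OF Suc])
  then have "((x + y) ^ (p ^ d)) ^ p - ((x ^ (p ^ d)) ^ p + (y ^ (p ^ d)) ^ p) \<in> I"
    by (rule cong_trans) (rule frobenius_add[OF assms])
  then show ?case
    by (simp add: power_mult[symmetric] mult.commute)
qed

lemma frobenius_power_sum:
  assumes "prime p" "of_nat p \<in> I"
  shows "(\<Sum>i\<in>A. f i) ^ (p ^ d) - (\<Sum>i\<in>A. f i ^ (p ^ d)) \<in> I"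
proof (induction A rule: infinite_finite_induct)
  case (insert a A)
  have "(f a + sum f A) ^ (p ^ d) - (f a ^ (p ^ d) + sum f A ^ (p ^ d)) \<in> I"
    by (rule frobenius_power_add[OF assms])
  moreover have "f a ^ (p ^ d) + sum f A ^ (p ^ d) - (f a ^ (p ^ d) + (\<Sum>i\<in>A. f i ^ (p ^ d))) \<in> I"
    using insert.IH by simp
  ultimately show ?case
    using insert.hyps by (auto intro: cong_trans)
qed (use assms(1) in \<open>auto simp: zero prime_gt_0_nat power_0_left\<close>)

lemma of_int_mem:
  assumes "of_nat p \<in> I" "int p dvd a"
  shows "of_int a \<in> I"
  using assms by (auto elim!: dvdE simp: mult_right)

text \<open>Fermat's little theorem follows from additivity of the Frobenius map, stepping from 0 up
  and down the integers.\<close>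

lemma fermat_of_int:
  assumes "prime p" "of_nat p \<in> I"
  shows "of_int a ^ (p ^ d) - of_int a \<in> I"
proof (induction d)
  case 0
  then show ?case by (simp add: zero)
next
  case (Suc d)
  have "of_int a ^ p - of_int a \<in> I"
  proof (induction a rule: int_induct[of _ 0])
    case base
    then show ?case
      using assms(1) prime_gt_0_nat by (simp add: zero zero_power)
  next
    case (step1 i)
    have "(of_int i + 1) ^ p - (of_int i ^ p + 1 ^ p) \<in> I"
      by (rule frobenius_add[OF assms])
    moreover have "of_int i ^ p + 1 ^ p - (of_int i + 1) \<in> I"
      using step1(2) by simp
    ultimately have "(of_int i + 1) ^ p - (of_int i + 1) \<in> I"
      by (rule cong_trans)
    then show ?case
      by (simp add: add.commute)
  next
    case (step2 i)
    have "(of_int (i - 1) + 1) ^ p - (of_int (i - 1) ^ p + 1 ^ p) \<in> I"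
      by (rule frobenius_add[OF assms])
    then have "of_int (i - 1) ^ p + 1 - of_int i ^ p \<in> I"
      using cong_sym by fastforce
    then have "of_int (i - 1) ^ p + 1 - of_int i \<in> I"
      using step2(2) by (rule cong_trans)
    then show ?case
      by (simp add: algebra_simps)
  qed
  moreover have "(of_int a ^ (p ^ d)) ^ p - of_int a ^ p \<in> I"
    by (rule cong_power[OF Suc])
  ultimately show ?case
    by (auto intro: cong_trans simp: power_mult[symmetric] mult.commute)
qed

end

section \<open>Prime ideals and polynomials with many roots modulo them\<close>

locale prime_ideal = ring_ideal +
  assumes one: "1 \<notin> I"
    and prime: "x * y \<in> I \<Longrightarrow> x \<in> I \<or> y \<in> I"
begin

lemma power_mem: "x ^ n \<in> I \<Longrightarrow> x \<in> I"
  using one prime by (induction n) auto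

lemma prod_mem: "prod f A \<in> I \<Longrightarrow> \<exists>i\<in>A. f i \<in> I"
  using one prime by (induction A rule: infinite_finite_induct) auto

text \<open>A factor \<open>X - a\<close> is split off for one root \<open>a\<close>; by primality
  the quotient vanishes modulo \<open>I\<close> at the remaining, incongruent roots.\<close>

lemma coeff_mem_of_many_roots:
  fixes Q :: "'a poly"
  assumes "degree Q < card A" "\<And>x. x \<in> A \<Longrightarrow> poly Q x \<in> I"
    and "\<And>x y. x \<in> A \<Longrightarrow> y \<in> A \<Longrightarrow> x - y \<in> I \<Longrightarrow> x = y"
  shows "coeff Q i \<in> I"
  using assms
proof (induction "degree Q" arbitrary: Q A i)
  case 0
  then obtain x where "x \<in> A" by fastforce
  from 0 obtain c where Q: "Q = [:c:]" by (metis degree_eq_zeroE)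
  then show ?case
    using 0(3)[OF \<open>x \<in> A\<close>] by (cases i) (auto simp: zero)
next
  case (Suc n)
  have fin: "finite A" using Suc.prems(1) card.infinite by fastforce
  from Suc.prems obtain a where a: "a \<in> A" by fastforce
  define S where "S = synthetic_div Q a"
  have Q: "Q = [:- a, 1:] * S + [:poly Q a:]"
    using synthetic_div_correct'[of a Q] by (simp add: S_def)
  have deg: "degree S = n"
    using Suc.hyps(2) by (simp add: S_def degree_synthetic_div)
  have "coeff S i \<in> I" for i
  proof (rule Suc.hyps(1)[of S "A - {a}"])
    show "degree S < card (A - {a})"
      using Suc.prems(1) Suc.hyps(2) deg a fin by simp
  next
    fix x assume x: "x \<in> A - {a}"
    have "poly Q x - poly Q a = (x - a) * poly S x"
      by (subst Q) (simp add: algebra_simps)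
    then have "(x - a) * poly S x \<in> I"
      using Suc.prems(2) x a by (metis diff DiffD1)
    then show "poly S x \<in> I"
      using prime Suc.prems(3) x a by blast
  qed (use deg Suc.prems(3) in auto)
  then have "coeff ([:- a, 1:] * S) i \<in> I"
    by (cases i) (auto simp: add mult_left uminus diff)
  moreover have "coeff [:poly Q a:] i \<in> I"
    using Suc.prems(2) a by (cases i) (auto simp: zero)
  ultimately show ?case
    by (subst Q, subst coeff_add) (rule add)
qed

end

section \<open>Norm forms of finite fields\<close>

text \<open>Krull's argument: take \<open>P\<close> maximal among the ideals that contain
  \<open>I\<close> but not \<open>w\<close>. If \<open>x\<close> and \<open>y\<close> lie outside
  \<open>P\<close>, adjoining either one captures \<open>w\<close>, so \<open>x * y\<close> in
  \<open>P\<close> would put \<open>w * w\<close> in \<open>P\<close>; the relation between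
  \<open>w ^ n\<close> and \<open>w\<close> then pulls \<open>w\<close> into
  \<open>P\<close>.\<close>

lemma exists_prime_ideal_avoiding:
  fixes I :: "'a::comm_ring_1 set"
  assumes "ring_ideal I" "w \<notin> I" "w ^ n - w \<in> I" "n \<ge> 2"
  obtains P where "prime_ideal P" "I \<subseteq> P" "w \<notin> P"
proof -
  define \<A> where "\<A> = {J. ring_ideal J \<and> I \<subseteq> J \<and> w \<notin> J}"
  have "\<exists>P\<in>\<A>. \<forall>J\<in>\<A>. P \<subseteq> J \<longrightarrow> J = P"
  proof (rule subset_Zorn_nonempty)
    show "\<A> \<noteq> {}"
      using assms by (auto simp: \<A>_def)
  next
    fix C assume C: "C \<noteq> {}" "subset.chain \<A> C"
    have "ring_ideal (\<Union>C)"
    proof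
      obtain J where "J \<in> C" using C(1) by blast
      then have "0 \<in> J"
        using C(2) by (auto simp: \<A>_def subset.chain_def dest: ring_ideal.zero)
      then show "0 \<in> \<Union>C" using \<open>J \<in> C\<close> by blast
    next
      fix x y assume "x \<in> \<Union>C" "y \<in> \<Union>C"
      then obtain J where "J \<in> C" "x \<in> J" "y \<in> J"
        using C(2) by (auto simp: subset_chain_def) (metis subset_iff)
      then show "x + y \<in> \<Union>C"
        using C(2) by (auto simp: \<A>_def subset.chain_def dest: ring_ideal.add)
    next
      fix x r assume "x \<in> \<Union>C"
      then show "r * x \<in> \<Union>C"
        using C(2) by (auto simp: \<A>_def subset.chain_def dest: ring_ideal.mult_left)
    qed
    then show "\<Union>C \<in> \<A>"
      using C by (auto simp: \<A>_def subset.chain_def)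
  qed
  then obtain P where P: "ring_ideal P" "I \<subseteq> P" "w \<notin> P"
    and max: "\<And>J. ring_ideal J \<Longrightarrow> I \<subseteq> J \<Longrightarrow> w \<notin> J \<Longrightarrow> P \<subseteq> J \<Longrightarrow> J = P"
    by (auto simp: \<A>_def)
  interpret P: ring_ideal P by fact
  have extend: "\<exists>u r. u \<in> P \<and> w = u + r * x" if "x \<notin> P" for x
  proof -
    define J where "J = {u + r * x |u r. u \<in> P}"
    have "ring_ideal J"
    proof
      show "0 \<in> J"
        using P.zero by (force simp: J_def intro: exI[of _ 0])
    next
      fix y z assume "y \<in> J" "z \<in> J"
      then obtain u r v s where "y = u + r * x" "u \<in> P" "z = v + s * x" "v \<in> P"
        by (auto simp: J_def)
      then have "y + z = (u + v) + (r + s) * x" "u + v \<in> P"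
        by (auto simp: algebra_simps P.add)
      then show "y + z \<in> J"
        unfolding J_def by blast
    next
      fix y t assume "y \<in> J"
      then obtain u r where "y = u + r * x" "u \<in> P"
        by (auto simp: J_def)
      then have "t * y = t * u + (t * r) * x" "t * u \<in> P"
        by (auto simp: algebra_simps P.mult_left)
      then show "t * y \<in> J"
        unfolding J_def by blast
    qed
    moreover have "P \<subseteq> J"
    proof
      fix u assume "u \<in> P"
      moreover have "u = u + 0 * x" by simp
      ultimately show "u \<in> J" unfolding J_def by blast
    qed
    moreover have "x \<in> J"
    proof -
      have "x = 0 + 1 * x" by simp
      then show ?thesis unfolding J_def using P.zero by blast
    qed
    ultimately have "w \<in> J"
      using max[of J] P(2) that by blast
    then show ?thesis
      by (auto simp: J_def)
  qed
  have "prime_ideal P"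
  proof
    show "1 \<notin> P"
      using P.mult_left[of 1 w] P(3) by auto
  next
    fix x y assume xy: "x * y \<in> P"
    show "x \<in> P \<or> y \<in> P"
    proof (rule ccontr)
      assume "\<not> ?thesis"
      then obtain u r v s where w: "w = u + r * x" "u \<in> P" "w = v + s * y" "v \<in> P"
        using extend by meson
      have "w * w = (u + r * x) * (v + s * y)"
        using w by simp
      also have "\<dots> = u * (v + s * y) + r * x * v + r * s * (x * y)"
        by (simp add: algebra_simps)
      also have "\<dots> \<in> P"
        by (rule P.add[OF P.add[OF P.mult_right[OF w(2)] P.mult_left[OF w(4)]] P.mult_left[OF xy]])
      finally have "w * w * w ^ (n - 2) \<in> P"
        by (rule P.mult_right)
      also have "w * w * w ^ (n - 2) = w ^ n"
        using assms(4) by (metis le_add_diff_inverse power2_eq_square power_add)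
      finally have "w ^ n \<in> P" .
      moreover have "w ^ n - w \<in> P"
        using assms(3) P(2) by blast
      ultimately show False
        using P.cong_mem P(3) by blast
    qed
  qed
  with P show thesis using that by blast
qed

text \<open>Modulo \<open>I\<close> the \<open>p ^ j\<close>-th power map is additive and
  multiplicative and fixes the integers and \<open>X\<close>, hence every
  \<open>pCons a f = a + X * f\<close>.\<close>

lemma frobenius_power_fixed:
  fixes I :: "int poly set"
  assumes "ring_ideal I" "prime p" "of_nat p \<in> I" "[:0, 1:] ^ (p ^ j) - [:0, 1:] \<in> I"
  shows "f ^ (p ^ j) - f \<in> I"
proof -
  interpret ring_ideal I by fact
  show ?thesis
  proof (induction f)
    case 0
    then show ?case
      using assms(2) prime_gt_0_nat by (simp add: zero power_0_left)
  next
    case (pCons a f)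
    have eq: "pCons a f = of_int a + [:0, 1:] * f"
      by (simp add: of_int_poly)
    have "([:0, 1:] * f) ^ (p ^ j) - [:0, 1:] * f \<in> I"
      unfolding power_mult_distrib by (rule cong_mult[OF assms(4) pCons.IH])
    then have "of_int a ^ (p ^ j) + ([:0, 1:] * f) ^ (p ^ j) - (of_int a + [:0, 1:] * f) \<in> I"
      by (rule cong_add[OF fermat_of_int[OF assms(2,3)]])
    with frobenius_power_add[OF assms(2,3)] show ?case
      unfolding eq by (rule cong_trans)
  qed
qed

text \<open>Supplies the degree bound for the product of \<open>X ^ (p ^ d) - X\<close> over
  \<open>1 <= d < j\<close>.\<close>

lemma sum_powers_less:
  fixes p :: nat
  assumes "p \<ge> 2" "j \<ge> 1"
  shows "(\<Sum>d=1..<j. p ^ d) < p ^ j"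
  using assms(2)
proof (induction j rule: dec_induct)
  case base
  then show ?case using assms by simp
next
  case (step n)
  have "(\<Sum>d=1..<Suc n. p ^ d) < 2 * p ^ n"
    using step by simp
  also have "\<dots> \<le> p ^ Suc n"
    using assms by simp
  finally show ?case .
qed

lemma lead_coeff_degree_X_power_diff:
  assumes "n > 1"
  shows "lead_coeff ([:0, 1::int:] ^ n - [:0, 1:]) = 1" "degree ([:0, 1::int:] ^ n - [:0, 1:]) = n"
proof -
  have "degree ([:0, 1::int:] ^ n - [:0, 1:]) = degree ([:0, 1::int:] ^ n + (- [:0, 1:]))"
    by (simp only: diff_conv_add_uminus)
  also have "\<dots> = degree ([:0, 1::int:] ^ n)"
    using assms by (intro degree_add_eq_left) (simp add: degree_linear_power degree_power_eq)
  finally show deg: "degree ([:0, 1::int:] ^ n - [:0, 1:]) = n"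
    by (simp add: degree_power_eq)
  have "[:0, 1::int:] ^ n = monom 1 n"
    by (simp add: monom_altdef)
  then show "lead_coeff ([:0, 1::int:] ^ n - [:0, 1:]) = 1"
    using assms unfolding deg by (simp add: coeff_pCons split: nat.splits)
qed

text \<open>Modulo \<open>p\<close>, a nonzero multiple of the monic \<open>X ^ n - X\<close> has
  degree at least \<open>n\<close>, whereas \<open>w\<close> has smaller degree and does not
  vanish.\<close>

lemma not_in_ideal_by_degree:
  fixes w :: "int poly"
  assumes "p > 1" "n > 1" "lead_coeff w = 1" "degree w < n"
  shows "w \<noteq> of_nat p * A + ([:0, 1:] ^ n - [:0, 1:]) * B"
proof
  assume eq: "w = of_nat p * A + ([:0, 1:] ^ n - [:0, 1:]) * B"
  have X: "[:0, 1::int:] ^ n - [:0, 1:] = monom 1 n - monom 1 1"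
    by (simp add: monom_altdef)
  have c: "coeff w i = int p * coeff A i + (coeff (monom 1 n * B) i - coeff (monom 1 1 * B) i)" for i
    unfolding eq X by (simp add: left_diff_distrib of_nat_poly)
  have B: "int p dvd coeff B b" for b
  proof (rule ccontr)
    assume "\<not> int p dvd coeff B b"
    moreover have "b \<le> degree B" if "\<not> int p dvd coeff B b" for b
      using that by (intro le_degree) auto
    \<comment> \<open>\<open>b\<close> is the degree of \<open>B\<close> modulo \<open>p\<close>;
      comparing coefficients at \<open>n + b\<close> forces \<open>p\<close> to divide
      \<open>coeff B b\<close>.\<close>
    ultimately obtain b where b: "\<not> int p dvd coeff B b" "\<And>b'. \<not> int p dvd coeff B b' \<Longrightarrow> b' \<le> b"
      using Greatest_le_nat[of "\<lambda>b. \<not> int p dvd coeff B b" _ "degree B"]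
        GreatestI_nat[of "\<lambda>b. \<not> int p dvd coeff B b" b "degree B"] by blast
    have "int p dvd coeff B (n + b - 1)"
      using b(2)[of "n + b - 1"] assms(2) by linarith
    moreover have "coeff w (n + b) = 0"
      using assms(4) by (intro coeff_eq_0) simp
    then have "0 = int p * coeff A (n + b) + (coeff B b - coeff B (n + b - 1))"
      using assms(2) by (simp add: c coeff_monom_mult)
    then have "coeff B b = coeff B (n + b - 1) - int p * coeff A (n + b)"
      by simp
    ultimately have "int p dvd coeff B b"
      by simp
    with b(1) show False by blast
  qed
  have "int p dvd coeff w (degree w)"
    unfolding c coeff_monom_mult by (auto simp: B)
  with assms(1,3) show False by auto
qed

text \<open>The residue field of such an ideal has \<open>p ^ j\<close> elements. Since \<open>w ^ (p ^ j)\<close> is congruent to \<open>w\<close>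
  modulo \<open>I\<close>, every ideal maximal among those containing \<open>I\<close> but not \<open>w\<close> is prime.\<close>

lemma exists_residue_field:
  assumes "prime p" "j \<ge> 1"
  obtains P :: "int poly set" where "prime_ideal P" "of_nat p \<in> P"
    "[:0, 1:] ^ (p ^ j) - [:0, 1:] \<in> P"
    "\<And>d. 1 \<le> d \<Longrightarrow> d < j \<Longrightarrow> [:0, 1:] ^ (p ^ d) - [:0, 1:] \<notin> P"
proof -
  define h :: "nat \<Rightarrow> int poly" where "h d = [:0, 1:] ^ (p ^ d) - [:0, 1:]" for d
  \<comment> \<open>Each \<open>h d\<close> with \<open>1 <= d < j\<close> divides \<open>w\<close>,
    so keeping \<open>w\<close> out of \<open>P\<close> keeps all of them out at once. The degree
    \<open>p + ... + p ^ (j - 1)\<close> is below \<open>p ^ j\<close>, which keeps \<open>w\<close>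
    out of \<open>I\<close>.\<close>
  define w where "w = (\<Prod>d=1..<j. h d)"
  define I where "I = {of_nat p * A + h j * B |A B. True}"
  have p: "p > 1" using assms(1) prime_gt_1_nat by blast
  have pd: "p ^ d > 1" if "d \<ge> 1" for d
    using p that by (intro one_less_power) auto
  have I: "ring_ideal I"
  proof
    show "0 \<in> I"
      unfolding I_def by (rule CollectI, rule exI[of _ 0], rule exI[of _ 0]) simp
  next
    fix x y assume "x \<in> I" "y \<in> I"
    then obtain A B C D where "x = of_nat p * A + h j * B" "y = of_nat p * C + h j * D"
      by (auto simp: I_def)
    then have "x + y = of_nat p * (A + C) + h j * (B + D)"
      by (simp add: algebra_simps)
    then show "x + y \<in> I" unfolding I_def by blast
  next
    fix x r assume "x \<in> I"
    then obtain A B where "x = of_nat p * A + h j * B"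
      by (auto simp: I_def)
    then have "r * x = of_nat p * (r * A) + h j * (r * B)"
      by (simp add: algebra_simps)
    then show "r * x \<in> I" unfolding I_def by blast
  qed
  have "of_nat p = of_nat p * 1 + h j * 0" by simp
  then have pI: "of_nat p \<in> I" unfolding I_def by blast
  have "h j = of_nat p * 0 + h j * 1" by simp
  then have hI: "h j \<in> I" unfolding I_def by blast
  have lc: "lead_coeff w = 1"
    unfolding w_def lead_coeff_prod
    using pd lead_coeff_degree_X_power_diff(1) by (intro prod.neutral) (auto simp: h_def)
  have "degree w = (\<Sum>d=1..<j. degree (h d))"
    unfolding w_def
  proof (intro degree_prod_eq_sum_degree ballI)
    fix i assume "i \<in> {1..<j}"
    then have "lead_coeff (h i) = 1"
      unfolding h_def by (intro lead_coeff_degree_X_power_diff(1) pd) auto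
    then show "h i \<noteq> 0" by auto
  qed
  also have "\<dots> = (\<Sum>d=1..<j. p ^ d)"
    unfolding h_def using pd by (intro sum.cong lead_coeff_degree_X_power_diff(2)) auto
  also have "\<dots> < p ^ j"
    using p assms(2) by (intro sum_powers_less) auto
  finally have deg: "degree w < p ^ j" .
  have "w \<notin> I"
    using not_in_ideal_by_degree[OF p pd[OF assms(2)] lc deg] by (auto simp: I_def h_def)
  moreover have "w ^ (p ^ j) - w \<in> I"
    using frobenius_power_fixed[OF I assms(1) pI] hI by (simp add: h_def)
  ultimately obtain P where P: "prime_ideal P" "I \<subseteq> P" "w \<notin> P"
    using exists_prime_ideal_avoiding[OF I, of w "p ^ j"] pd[OF assms(2)] by auto
  interpret prime_ideal P by fact
  have "h d \<notin> P" if "1 \<le> d" "d < j" for d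
  proof
    assume "h d \<in> P"
    moreover have "w = h d * (\<Prod>i\<in>{1..<j} - {d}. h i)"
      unfolding w_def using that by (intro prod.remove) auto
    ultimately show False
      using P(3) by (simp add: mult_right)
  qed
  then show thesis
    using that[of P] P pI hI by (auto simp: h_def)
qed

section \<open>Finite differences of polynomials\<close>

text \<open>The constant term is annihilated, and
  \<open>i * (Suc n choose i) = Suc n * (n choose (i - 1))\<close> for \<open>i >= 1\<close> turns
  the remaining part \<open>X * R\<close> into an \<open>n\<close>-th difference of the shifted
  polynomial \<open>R (X + 1)\<close>, which has the same coefficient at \<open>n\<close>.\<close>

lemma alternating_sum_poly:
  fixes Q :: "'a::idom poly"
  assumes "degree Q \<le> n"
  shows "(\<Sum>i\<le>n. (-1) ^ i * of_nat (n choose i) * poly Q (of_nat i)) = (-1) ^ n * of_nat (fact n) * coeff Q n"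
  using assms
proof (induction n arbitrary: Q)
  case 0
  then obtain c where "Q = [:c:]" by (metis degree_eq_zeroE le_zero_eq)
  then show ?case by simp
next
  case (Suc n)
  obtain a R where Q: "Q = pCons a R" by (rule pCons_cases)
  have R: "degree R \<le> n"
    using Suc.prems by (auto simp: Q degree_pCons_eq_if split: if_splits)
  define S where "S = R \<circ>\<^sub>p [:1, 1:]"
  have S: "degree S \<le> n"
    using R by (simp add: S_def degree_pcompose)
  have coeff: "coeff S n = coeff R n"
  proof (cases "degree R = n")
    case True
    then have "coeff S n = lead_coeff S"
      by (simp add: S_def degree_pcompose)
    also have "\<dots> = lead_coeff R"
      by (simp add: S_def lead_coeff_comp)
    finally show ?thesis using True by simp
  next
    case False
    then show ?thesis
      using R by (simp add: S_def degree_pcompose coeff_eq_0)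
  qed
  have "(\<Sum>i\<le>Suc n. (-1) ^ i * of_nat (Suc n choose i) * poly Q (of_nat i)) =
      a * (\<Sum>i\<le>Suc n. (-1) ^ i * of_nat (Suc n choose i)) +
      (\<Sum>i\<le>Suc n. (-1) ^ i * of_nat (Suc n choose i) * (of_nat i * poly R (of_nat i)))"
    by (simp only: Q poly_pCons distrib_left sum.distrib sum_distrib_left mult_ac)
  also have "(\<Sum>i\<le>Suc n. (-1) ^ i * of_nat (Suc n choose i)) = (0::'a)"
    by (rule choose_alternating_sum) simp
  also have "(\<Sum>i\<le>Suc n. (-1) ^ i * of_nat (Suc n choose i) * (of_nat i * poly R (of_nat i))) =
      (\<Sum>i\<le>n. (-1) ^ Suc i * of_nat (Suc n choose Suc i) * (of_nat (Suc i) * poly R (of_nat (Suc i))))"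
    by (subst sum.atMost_Suc_shift) simp
  also have "\<dots> = (\<Sum>i\<le>n. - of_nat (Suc n) * ((-1) ^ i * of_nat (n choose i) * poly S (of_nat i)))"
  proof (rule sum.cong)
    fix i
    have "of_nat (Suc i) * of_nat (Suc n choose Suc i) = (of_nat (Suc n) * of_nat (n choose i) :: 'a)"
      by (simp only: of_nat_mult[symmetric] Suc_times_binomial_eq mult.commute)
    moreover have "poly R (of_nat (Suc i)) = poly S (of_nat i)"
      by (simp add: S_def poly_pcompose)
    moreover have "(-1) ^ Suc i * of_nat (Suc n choose Suc i) * (of_nat (Suc i) * poly R (of_nat (Suc i))) =
        - ((-1) ^ i * (of_nat (Suc i) * of_nat (Suc n choose Suc i)) * poly R (of_nat (Suc i)))"
      by (simp del: of_nat_Suc binomial_Suc_Suc add: mult_ac)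
    ultimately show "(-1) ^ Suc i * of_nat (Suc n choose Suc i) * (of_nat (Suc i) * poly R (of_nat (Suc i))) =
        - of_nat (Suc n) * ((-1) ^ i * of_nat (n choose i) * poly S (of_nat i))"
      by (simp only: mult_minus_left mult_ac)
  qed simp
  also have "\<dots> = - of_nat (Suc n) * ((-1) ^ n * of_nat (fact n) * coeff R n)"
    by (simp only: sum_distrib_left[symmetric] Suc.IH[OF S] coeff)
  also have "a * 0 + \<dots> = (-1) ^ Suc n * of_nat (fact (Suc n)) * coeff Q (Suc n)"
    by (simp add: Q algebra_simps)
  finally show ?case .
qed

lemma degree_prod_linear_le: "degree (\<Prod>i<n. [:a i, b i:]) \<le> n"
proof (induction n)
  case (Suc n)
  have "degree (\<Prod>i<Suc n. [:a i, b i:]) \<le> degree (\<Prod>i<n. [:a i, b i:]) + degree [:a n, b n:]"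
    unfolding prod.lessThan_Suc by (rule degree_mult_le)
  also have "\<dots> \<le> Suc n"
    using Suc by (simp add: degree_pCons_eq_if)
  finally show ?case .
qed simp

lemma coeff_prod_linear:
  fixes a b :: "nat \<Rightarrow> 'a::comm_semiring_1"
  shows "coeff (\<Prod>i<n. [:a i, b i:]) n = (\<Prod>i<n. b i)"
proof (induction n)
  case (Suc n)
  have "coeff (\<Prod>i<n. [:a i, b i:]) (Suc n) = 0"
    using degree_prod_linear_le[where n = n and a = a and b = b] by (intro coeff_eq_0) auto
  then show ?case
    using Suc by (simp add: mult.commute)
qed simp

section \<open>Norms and Frobenius conjugates modulo a prime ideal\<close>

context prime_ideal
begin

lemma of_int_mem_iff:
  assumes "prime p" "of_nat p \<in> I"
  shows "of_int a \<in> I \<longleftrightarrow> int p dvd a"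
proof
  assume a: "of_int a \<in> I"
  show "int p dvd a"
  proof (rule ccontr)
    assume "\<not> int p dvd a"
    then have "coprime (int p) a"
      using assms(1) by (intro prime_imp_coprime) auto
    then obtain u v where "u * int p + v * a = 1"
      using bezout_int[of "int p" a] by (auto simp: coprime_iff_gcd_eq_1)
    then have "1 = of_int u * of_nat p + of_int v * (of_int a :: 'a)"
      by (metis of_int_1 of_int_add of_int_mult of_int_of_nat_eq)
    also have "\<dots> \<in> I"
      using a assms(2) by (intro add mult_left)
    finally show False using one by blast
  qed
qed (rule of_int_mem[OF assms(2)])

text \<open>\<open>X ^ p - X\<close> has the incongruent roots \<open>0, ..., p - 1\<close> modulo
  \<open>I\<close>. An element \<open>z\<close> incongruent to all of them would be root number
  \<open>p + 1\<close> and force the leading coefficient 1 into \<open>I\<close>.\<close>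

lemma cong_of_int_if_frobenius_fixed:
  assumes "prime p" "of_nat p \<in> I" "z ^ p - z \<in> I"
  shows "\<exists>n. z - of_int n \<in> I"
proof (rule ccontr)
  assume not: "\<not> ?thesis"
  have p: "p > 1" using assms(1) prime_gt_1_nat by blast
  define Q :: "'a poly" where "Q = monom 1 p - monom 1 1"
  define A where "A = insert z (of_int ` {0..<int p})"
  have dist: "a = b" if "a \<in> {0..<int p}" "b \<in> {0..<int p}" "of_int a - of_int b \<in> I" for a b
  proof -
    have "of_int (a - b) \<in> I" using that by simp
    then have "int p dvd a - b" using of_int_mem_iff[OF assms(1,2)] by blast
    then have "a mod int p = b mod int p" by (simp add: mod_eq_dvd_iff)
    then show ?thesis using that by simp
  qed
  have "inj_on (of_int :: int \<Rightarrow> 'a) {0..<int p}"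
  proof (rule inj_onI)
    fix a b :: int assume "a \<in> {0..<int p}" "b \<in> {0..<int p}" "(of_int a :: 'a) = of_int b"
    then show "a = b" using dist[of a b] zero by simp
  qed
  moreover have "z \<notin> of_int ` {0..<int p}"
    by (metis diff_self image_iff not zero)
  ultimately have card: "card A = Suc p"
    by (simp add: A_def card_image)
  have "degree Q \<le> p"
    unfolding Q_def using p by (intro degree_diff_le degree_monom_le order_trans[OF degree_monom_le]) auto
  then have "degree Q < card A"
    using card by simp
  moreover have "poly Q x \<in> I" if "x \<in> A" for x
  proof -
    have "of_int a ^ p - of_int a \<in> I" for a
      using fermat_of_int[OF assms(1,2), of a 1] by simp
    then show ?thesis
      using that assms(3) by (auto simp: A_def Q_def poly_monom)
  qed
  moreover have "x = y" if "x \<in> A" "y \<in> A" "x - y \<in> I" for x y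
    using that dist not cong_sym unfolding A_def by blast
  ultimately have "coeff Q p \<in> I"
    by (rule coeff_mem_of_many_roots)
  then show False
    using p one by (simp add: Q_def)
qed

lemma frobenius_power_diff:
  assumes "prime p" "of_nat p \<in> I"
  shows "(x ^ (p ^ d) - y ^ (p ^ d)) - (x - y) ^ (p ^ d) \<in> I"
  using frobenius_power_add[OF assms, of "x - y" y d] by (simp add: algebra_simps)

text \<open>The \<open>p\<close>-th power permutes the conjugates \<open>y ^ (p ^ i)\<close>
  cyclically, since \<open>y ^ (p ^ j)\<close> returns to \<open>y\<close>. So the norm is fixed by
  Frobenius and lies in the prime field.\<close>

lemma norm_cong_of_int:
  assumes "prime p" "of_nat p \<in> I" "y ^ (p ^ j) - y \<in> I" "j \<ge> 1"
  shows "\<exists>n. (\<Prod>i<j. y ^ (p ^ i)) - of_int n \<in> I"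
proof (rule cong_of_int_if_frobenius_fixed[OF assms(1,2)])
  obtain r where j: "j = Suc r" using assms(4) by (cases j) auto
  define M where "M = (\<Prod>i<r. y ^ (p ^ Suc i))"
  have "(\<Prod>i<j. y ^ (p ^ i)) = y * M"
    unfolding j M_def by (subst prod.lessThan_Suc_shift) simp
  moreover have "(\<Prod>i<j. y ^ (p ^ i)) ^ p = (\<Prod>i<j. y ^ (p ^ Suc i))"
    by (simp add: prod_power_distrib power_mult[symmetric] mult.commute)
  then have "(\<Prod>i<j. y ^ (p ^ i)) ^ p = y ^ (p ^ j) * M"
    by (simp add: j M_def mult.commute)
  moreover have "y ^ (p ^ j) * M - y * M \<in> I"
    using assms(3) by (metis left_diff_distrib mult_right)
  ultimately show "(\<Prod>i<j. y ^ (p ^ i)) ^ p - (\<Prod>i<j. y ^ (p ^ i)) \<in> I"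
    by simp
qed

text \<open>An element all of whose first \<open>j\<close> Frobenius conjugates are distinct
  satisfies no nontrivial equation of degree less than \<open>j\<close> over the prime field.\<close>

lemma powers_independent:
  assumes "prime p" "of_nat p \<in> I"
    and "\<And>d. 1 \<le> d \<Longrightarrow> d < j \<Longrightarrow> x ^ (p ^ d) - x \<notin> I"
    and "(\<Sum>l<j. of_int (a l) * x ^ l) \<in> I" "l < j"
  shows "int p dvd a l"
proof (rule ccontr)
  assume l: "\<not> int p dvd a l"
  define E where "E = {l. l < j \<and> \<not> int p dvd a l}"
  have E: "finite E" "E \<noteq> {}"
    using l assms(5) by (auto simp: E_def)
  define e where "e = Max E"
  have e: "e < j" "\<not> int p dvd a e"
    using Max_in[OF E] by (auto simp: E_def e_def)
  have gt: "int p dvd a l" if "l > e" "l < j" for l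
  proof (rule ccontr)
    assume "\<not> int p dvd a l"
    then have "l \<le> e"
      unfolding e_def using that E(1) by (intro Max_ge) (auto simp: E_def)
    then show False using that by simp
  qed
  \<comment> \<open>Cutting the sum at \<open>e\<close> changes its value only by an element of
    \<open>I\<close> and leaves a coefficient at \<open>e\<close> outside \<open>I\<close>, although
    \<open>e + 1\<close> incongruent conjugates of \<open>x\<close> turn out to be roots.\<close>
  define Q :: "'a poly" where "Q = (\<Sum>l\<le>e. monom (of_int (a l)) l)"
  have poly_Q: "poly Q y = (\<Sum>l\<le>e. of_int (a l) * y ^ l)" for y
    by (simp add: Q_def poly_sum poly_monom)
  have "{..<j} = {..e} \<union> {e<..<j}" using e(1) by auto
  then have "(\<Sum>l<j. of_int (a l) * x ^ l) = poly Q x + (\<Sum>l\<in>{e<..<j}. of_int (a l) * x ^ l)"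
    by (simp add: poly_Q sum.union_disjoint disjoint_iff)
  moreover have "(\<Sum>l\<in>{e<..<j}. of_int (a l) * x ^ l) \<in> I"
    using gt by (intro sum mult_right of_int_mem[OF assms(2)]) auto
  ultimately have root: "poly Q x \<in> I"
    using assms(4) diff by (metis add_diff_cancel_right')
  have roots: "poly Q (x ^ (p ^ i)) \<in> I" for i
  proof -
    have "(poly Q x) ^ (p ^ i) - (\<Sum>l\<le>e. (of_int (a l) * x ^ l) ^ (p ^ i)) \<in> I"
      unfolding poly_Q by (rule frobenius_power_sum[OF assms(1,2)])
    moreover have "(\<Sum>l\<le>e. (of_int (a l) * x ^ l) ^ (p ^ i)) - poly Q (x ^ (p ^ i)) \<in> I"
      unfolding poly_Q
    proof (rule cong_sum)
      fix l
      have "(x ^ (p ^ i)) ^ l = (x ^ l) ^ (p ^ i)"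
        by (simp add: power_mult[symmetric] mult.commute)
      then show "(of_int (a l) * x ^ l) ^ (p ^ i) - of_int (a l) * (x ^ (p ^ i)) ^ l \<in> I"
        using mult_right[OF fermat_of_int[OF assms(1,2)]]
        by (simp add: power_mult_distrib left_diff_distrib)
    qed
    ultimately have "(poly Q x) ^ (p ^ i) - poly Q (x ^ (p ^ i)) \<in> I"
      by (rule cong_trans)
    moreover have "(poly Q x) ^ (p ^ i) \<in> I"
      using root prime_gt_0_nat[OF assms(1)] by (intro mem_power) simp_all
    ultimately show ?thesis
      using cong_mem by blast
  qed
  \<comment> \<open>The difference is congruent to the \<open>p ^ c\<close>-th power of
    \<open>x ^ (p ^ (b - c)) - x\<close>, which lies outside the prime ideal since
    \<open>b - c < j\<close>.\<close>
  have less: "x ^ (p ^ b) - x ^ (p ^ c) \<notin> I" if "c < b" "b \<le> e" for b c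
  proof
    assume *: "x ^ (p ^ b) - x ^ (p ^ c) \<in> I"
    have "b = (b - c) + c" using that by simp
    then have "x ^ (p ^ b) = (x ^ (p ^ (b - c))) ^ (p ^ c)"
      by (metis power_add power_mult)
    with * have "(x ^ (p ^ (b - c))) ^ (p ^ c) - x ^ (p ^ c) \<in> I" by simp
    then have "(x ^ (p ^ (b - c)) - x) ^ (p ^ c) \<in> I"
      using cong_mem[OF frobenius_power_diff[OF assms(1,2)]] by blast
    then have "x ^ (p ^ (b - c)) - x \<in> I"
      by (rule power_mem)
    then show False
      using assms(3)[of "b - c"] that e(1) by simp
  qed
  have dist: "b = c" if "b \<le> e" "c \<le> e" "x ^ (p ^ b) - x ^ (p ^ c) \<in> I" for b c
    using less[of b c] less[of c b] that cong_sym by (metis linorder_neqE_nat)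
  define A where "A = (\<lambda>i. x ^ (p ^ i)) ` {..e}"
  have "inj_on (\<lambda>i. x ^ (p ^ i)) {..e}"
    using dist by (intro inj_onI) (simp add: zero)
  then have "card A = Suc e"
    by (simp add: A_def card_image)
  moreover have "degree Q \<le> e"
    unfolding Q_def by (intro degree_sum_le order_trans[OF degree_monom_le]) auto
  ultimately have "degree Q < card A" by simp
  then have "coeff Q e \<in> I"
    by (rule coeff_mem_of_many_roots) (use roots dist in \<open>auto simp: A_def\<close>)
  moreover have "coeff Q e = of_int (a e)"
    by (simp add: Q_def coeff_sum if_distrib cong: if_cong)
  ultimately show False
    using of_int_mem_iff[OF assms(1,2)] e(2) by simp
qed

end

text \<open>The last condition says, in terms of \<open>n\<close>-th differences, that modulo \<open>p\<close> the function \<open>g\<close> is on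
  every line \<open>s + i v\<close> a polynomial in \<open>i\<close> of degree at most \<open>j\<close> with leading coefficient \<open>g v\<close>. Forms of
  different degrees come from unrelated residue fields; differences let them be added as integers.\<close>

definition anisotropic_form :: "nat \<Rightarrow> nat \<Rightarrow> ((nat \<Rightarrow> int) \<Rightarrow> int) \<Rightarrow> bool" where
  "anisotropic_form p j g \<longleftrightarrow>
     (\<forall>v w. (\<forall>l<j. v l = w l) \<longrightarrow> g v = g w) \<and>
     (\<forall>v. int p dvd g v \<longrightarrow> (\<forall>l<j. int p dvd v l)) \<and>
     (odd j \<longrightarrow> (\<forall>v. int p dvd g v + g (\<lambda>l. - v l))) \<and>
     (\<forall>s v. \<forall>n\<ge>j. int p dvd
        (\<Sum>i\<le>n. (-1) ^ i * int (n choose i) * g (\<lambda>l. s l + int i * v l))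
        - (if n = j then (-1) ^ n * int (fact n) * g v else 0))"

text \<open>The form is the norm of the element with coordinates \<open>v\<close> in the powers of
  \<open>X\<close>: a product of \<open>j\<close> conjugates modulo \<open>P\<close>, replaced by a
  congruent integer. It vanishes only if some conjugate does, hence only if the element
  does.\<close>

lemma exists_anisotropic_form:
  assumes "prime p" "j \<ge> 1"
  shows "\<exists>g. anisotropic_form p j g"
proof -
  define X :: "int poly" where "X = [:0, 1:]"
  obtain P :: "int poly set" where P: "prime_ideal P" and pP: "of_nat p \<in> P"
    and q: "X ^ (p ^ j) - X \<in> P" and conj: "\<And>d. 1 \<le> d \<Longrightarrow> d < j \<Longrightarrow> X ^ (p ^ d) - X \<notin> P"
    unfolding X_def using exists_residue_field[OF assms] by blast
  interpret prime_ideal P by fact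
  have P': "ring_ideal P" by unfold_locales
  note mem_iff = of_int_mem_iff[OF assms(1) pP]
  \<comment> \<open>\<open>L i v\<close> is congruent to the conjugate
    \<open>L 0 v ^ (p ^ i)\<close>, but it is linear in \<open>v\<close> exactly and not just modulo
    \<open>P\<close>.\<close>
  define L where "L i v = (\<Sum>l<j. of_int (v l) * X ^ (l * p ^ i))" for i and v :: "nat \<Rightarrow> int"
  define N where "N v = (\<Prod>i<j. L i v)" for v
  have L_frob: "L 0 v ^ (p ^ i) - L i v \<in> P" for i v
  proof -
    have "L 0 v ^ (p ^ i) - (\<Sum>l<j. (of_int (v l) * X ^ l) ^ (p ^ i)) \<in> P"
      unfolding L_def using frobenius_power_sum[OF assms(1) pP] by simp
    moreover have "(\<Sum>l<j. (of_int (v l) * X ^ l) ^ (p ^ i)) - L i v \<in> P"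
      unfolding L_def
    proof (rule cong_sum)
      fix l
      show "(of_int (v l) * X ^ l) ^ (p ^ i) - of_int (v l) * X ^ (l * p ^ i) \<in> P"
        using mult_right[OF fermat_of_int[OF assms(1) pP]]
        by (simp add: power_mult_distrib left_diff_distrib power_mult)
    qed
    ultimately show ?thesis by (rule cong_trans)
  qed
  have "\<exists>n. N v - of_int n \<in> P" for v
  proof -
    obtain n where "(\<Prod>i<j. L 0 v ^ (p ^ i)) - of_int n \<in> P"
      using norm_cong_of_int[OF assms(1) pP _ assms(2)]
        frobenius_power_fixed[OF P' assms(1) pP] q by (metis X_def)
    moreover have "(\<Prod>i<j. L 0 v ^ (p ^ i)) - N v \<in> P"
      unfolding N_def by (intro cong_prod L_frob)
    ultimately show ?thesis
      using cong_sym cong_trans by blast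
  qed
  then obtain g' where g': "\<And>v. N v - of_int (g' v) \<in> P" by metis
  \<comment> \<open>The integers \<open>g' v\<close> come from a choice and might differ for
    functions that agree below \<open>j\<close>; truncation makes \<open>g\<close> depend on the
    first \<open>j\<close> values only.\<close>
  define r where "r v = (\<lambda>l. if l < j then v l else (0::int))" for v
  define g where "g v = g' (r v)" for v
  have N_cong: "N v = N w" if "\<And>l. l < j \<Longrightarrow> v l = w l" for v w
    unfolding N_def L_def using that by (intro prod.cong sum.cong) auto
  have g: "N v - of_int (g v) \<in> P" for v
    using g'[of "r v"] N_cong[of v "r v"] by (simp add: g_def r_def)
  have "anisotropic_form p j g"
    unfolding anisotropic_form_def
  proof (intro conjI allI impI)
    fix v w :: "nat \<Rightarrow> int" assume "\<forall>l<j. v l = w l"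
    then have "r v = r w" by (auto simp: r_def)
    then show "g v = g w" by (simp add: g_def)
  next
    fix v l assume "int p dvd g v" "l < j"
    then have "N v \<in> P"
      using cong_mem[OF g] mem_iff by blast
    then obtain i where "L i v \<in> P"
      unfolding N_def using prod_mem by blast
    then have "L 0 v ^ (p ^ i) \<in> P"
      using cong_mem[OF L_frob] by blast
    then have "L 0 v \<in> P"
      by (rule power_mem)
    then have "(\<Sum>l<j. of_int (v l) * X ^ l) \<in> P"
      by (simp add: L_def)
    then show "int p dvd v l"
      using powers_independent[OF assms(1) pP conj] \<open>l < j\<close> by blast
  next
    fix v assume "odd j"
    have "N (\<lambda>l. - v l) = (\<Prod>i<j. - 1 * L i v)"
      by (simp add: N_def L_def sum_negf)
    also have "\<dots> = - N v"
      unfolding prod.distrib using \<open>odd j\<close> by (simp add: N_def)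
    finally have "N v + N (\<lambda>l. - v l) = 0" by simp
    moreover have "N v + N (\<lambda>l. - v l) - (of_int (g v) + of_int (g (\<lambda>l. - v l))) \<in> P"
      by (intro cong_add g)
    ultimately have "of_int (g v + g (\<lambda>l. - v l)) \<in> P"
      by (metis cong_mem of_int_add zero)
    then show "int p dvd g v + g (\<lambda>l. - v l)"
      using mem_iff by blast
  next
    fix s v n assume n: "n \<ge> j"
    \<comment> \<open>On the line \<open>s + i v\<close> every conjugate is linear in
      \<open>i\<close>, so the norm is the value at \<open>i\<close> of a polynomial of degree at
      most \<open>j\<close> whose coefficient at \<open>j\<close> is \<open>N v\<close>.\<close>
    define Q where "Q = (\<Prod>i<j. [:L i s, L i v:])"
    have deg: "degree Q \<le> j"
      unfolding Q_def by (rule degree_prod_linear_le)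
    have coeff: "coeff Q n = (if n = j then N v else 0)"
      using deg n unfolding Q_def N_def by (auto simp: coeff_prod_linear coeff_eq_0)
    have Q: "poly Q (of_nat i) = N (\<lambda>l. s l + int i * v l)" for i
      by (simp add: Q_def N_def L_def poly_prod sum.distrib sum_distrib_left algebra_simps)
    define c where "c i = (-1) ^ i * int (n choose i)" for i
    have "of_int (\<Sum>i\<le>n. c i * g (\<lambda>l. s l + int i * v l)) -
        (\<Sum>i\<le>n. of_int (c i) * poly Q (of_nat i)) \<in> P"
      unfolding of_int_sum of_int_mult Q
      by (intro cong_sum cong_mult g[THEN cong_sym]) (simp add: zero)
    also have "(\<Sum>i\<le>n. of_int (c i) * poly Q (of_nat i)) = (-1) ^ n * of_nat (fact n) * coeff Q n"
      using alternating_sum_poly[of Q n] deg n by (simp add: c_def)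
    finally have "of_int (\<Sum>i\<le>n. c i * g (\<lambda>l. s l + int i * v l)) - (-1) ^ n * of_nat (fact n) * coeff Q n \<in> P" .
    moreover have "(-1) ^ n * of_nat (fact n) * coeff Q n
        - of_int (if n = j then (-1) ^ n * int (fact n) * g v else 0) \<in> P"
      using mult_left[OF g] by (simp add: coeff zero right_diff_distrib[symmetric])
    ultimately have "of_int (\<Sum>i\<le>n. c i * g (\<lambda>l. s l + int i * v l))
        - of_int (if n = j then (-1) ^ n * int (fact n) * g v else 0) \<in> P"
      by (rule cong_trans)
    then show "int p dvd (\<Sum>i\<le>n. (-1) ^ i * int (n choose i) * g (\<lambda>l. s l + int i * v l))
        - (if n = j then (-1) ^ n * int (fact n) * g v else 0)"
      unfolding of_int_diff[symmetric] mem_iff c_def .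
  qed
  then show ?thesis by blast
qed

section \<open>A prime between \<open>n\<close> and \<open>2n\<close>\<close>

lemma prod_primes_dvd:
  fixes n :: nat
  assumes "finite A" "\<And>p. p \<in> A \<Longrightarrow> prime p" "\<And>p. p \<in> A \<Longrightarrow> p dvd n"
  shows "\<Prod>A dvd n"
  using assms
proof (induction A rule: finite_induct)
  case (insert p A)
  have "coprime p (\<Prod>A)"
    using insert by (intro prod_coprime_right) (metis insertI1 insertI2 primes_coprime)
  then show ?case
    using insert by (simp add: divides_mult)
qed simp

text \<open>The row \<open>2 * m + 1\<close> contains this entry twice and has sum
  \<open>2 * 4 ^ m\<close>.\<close>

lemma choose_odd_middle_le: "(2 * m + 1) choose m \<le> 4 ^ m"
proof -
  have "(2 * m + 1) choose (m + 1) = (2 * m + 1) choose m"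
    using binomial_symmetric[of m "2 * m + 1"] by simp
  then have "2 * ((2 * m + 1) choose m) = (\<Sum>k\<in>{m, m + 1}. (2 * m + 1) choose k)"
    by simp
  also have "\<dots> \<le> (\<Sum>k\<le>2 * m + 1. (2 * m + 1) choose k)"
    by (intro sum_mono2) auto
  also have "\<dots> = 2 * 4 ^ m"
    unfolding choose_row_sum by (simp add: power_mult)
  finally show ?thesis by simp
qed

text \<open>Erdos' induction: for \<open>n = 2 * m + 1\<close> the primes in
  \<open>(m + 1, n]\<close> all divide \<open>n choose m\<close>, which is at most
  \<open>4 ^ m\<close>, and those up to \<open>m + 1\<close> are covered by induction. An even
  \<open>n > 2\<close> contributes no prime.\<close>

lemma primorial_le: "\<Prod>{p::nat. prime p \<and> p \<le> n} \<le> 4 ^ n"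
proof (induction n rule: less_induct)
  case (less n)
  consider "n < 2" | "n = 2" | "n > 2" "even n" | "n > 2" "odd n"
    using linorder_less_linear[of n 2] by blast
  then show ?case
  proof cases
    case 1
    then have "{p::nat. prime p \<and> p \<le> n} = {}"
      by (auto dest: prime_ge_2_nat)
    then show ?thesis by (simp only: prod.empty) simp
  next
    case 2
    then have "{p::nat. prime p \<and> p \<le> n} = {2}"
      by (auto dest: prime_ge_2_nat)
    then show ?thesis using 2 by simp
  next
    case 3
    then have "\<not> prime n"
      using prime_odd_nat by blast
    then have "{p::nat. prime p \<and> p \<le> n} = {p::nat. prime p \<and> p \<le> n - 1}"
    proof (intro Collect_cong conj_cong refl)
      fix p :: nat assume "prime p"
      then have "p \<noteq> n" using \<open>\<not> prime n\<close> by blast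
      then show "p \<le> n \<longleftrightarrow> p \<le> n - 1" by auto
    qed
    moreover have "\<Prod>{p::nat. prime p \<and> p \<le> n - 1} \<le> 4 ^ (n - 1)"
      using 3 by (intro less.IH) auto
    ultimately have "\<Prod>{p::nat. prime p \<and> p \<le> n} \<le> 4 ^ (n - 1)"
      by simp
    also have "(4::nat) ^ (n - 1) \<le> 4 ^ n"
      by (intro power_increasing) auto
    finally show ?thesis .
  next
    case 4
    then obtain m where n: "n = 2 * m + 1" by (auto elim!: oddE)
    then have m: "m \<ge> 1" using 4 by simp
    let ?A = "{p::nat. prime p \<and> p \<le> m + 1}" and ?B = "{p::nat. prime p \<and> m + 1 < p \<and> p \<le> n}"
    have "{p::nat. prime p \<and> p \<le> n} = ?A \<union> ?B"
      using n by auto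
    then have "\<Prod>{p::nat. prime p \<and> p \<le> n} = \<Prod>?A * \<Prod>?B"
      by (simp add: prod.union_disjoint disjoint_iff)
    moreover have "\<Prod>?A \<le> 4 ^ (m + 1)"
      using m n by (intro less.IH) auto
    moreover have "\<Prod>?B dvd n choose m"
    proof (rule prod_primes_dvd)
      fix p assume p: "p \<in> ?B"
      have "fact n = fact m * fact (n - m) * (n choose m)"
        using binomial_fact_lemma[of m n] n by simp
      moreover have "p dvd fact n"
        using p by (simp add: prime_dvd_fact_iff)
      moreover have "\<not> p dvd fact m" "\<not> p dvd fact (n - m)"
        using p n by (auto simp: prime_dvd_fact_iff simp del: fact_Suc)
      ultimately show "p dvd n choose m"
        using p by (metis (no_types, lifting) mem_Collect_eq prime_dvd_mult_iff)
    qed auto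
    then have "\<Prod>?B \<le> n choose m"
      using n by (intro dvd_imp_le) auto
    then have "\<Prod>?B \<le> 4 ^ m"
      using choose_odd_middle_le[of m] n by simp
    ultimately have "\<Prod>{p::nat. prime p \<and> p \<le> n} \<le> 4 ^ (m + 1) * 4 ^ m"
      by (simp add: mult_le_mono)
    then show ?thesis
      by (simp add: n power_add mult_2 mult.assoc)
  qed
qed

text \<open>The reciprocals of \<open>(n + 1) * (n choose k)\<close> form Leibniz' harmonic triangle,
  in which every entry is the difference of two entries closer to the boundary.\<close>

lemma Suc_times_choose_dvd:
  assumes "\<And>i. 1 \<le> i \<Longrightarrow> i \<le> Suc n \<Longrightarrow> i dvd D" "k \<le> n"
  shows "Suc n * (n choose k) dvd D"
proof -
  have "real D / real (Suc n * (n choose k)) \<in> \<int>"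
    using assms
  proof (induction k arbitrary: n)
    case 0
    then have "Suc n dvd D" by simp
    then obtain c where "D = Suc n * c" ..
    then have "real D / real (Suc n * (n choose 0)) = real c"
      by (simp only: binomial_n_0 of_nat_mult mult_1_right) (simp del: of_nat_Suc)
    then show ?case by simp
  next
    case (Suc k)
    obtain m where n: "n = Suc m" using Suc.prems(2) by (cases n) auto
    have km: "k \<le> m" using Suc.prems n by simp
    have "real D / real (Suc m * (m choose k)) \<in> \<int>"
      using Suc.prems n km by (intro Suc.IH) auto
    moreover have "real D / real (Suc n * (n choose k)) \<in> \<int>"
      using Suc.prems by (intro Suc.IH) auto
    moreover have "real D / real (Suc n * (n choose Suc k)) =
        real D / real (Suc m * (m choose k)) - real D / real (Suc n * (n choose k))"
    proof -
      define x where "x = real (m choose k)"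
      have x: "x > 0" using km by (simp add: x_def)
      have 1: "real (Suc k) * real (n choose Suc k) = real (Suc m) * x"
        unfolding n x_def of_nat_mult[symmetric] by (simp only: Suc_times_binomial_eq mult.commute)
      have "(Suc m - k) * (n choose k) = Suc m * (m choose k)"
        unfolding n by (simp only: binomial_absorb_comp diff_Suc_1)
      then have "real (Suc m - k) * real (n choose k) = real (Suc m) * x"
        unfolding x_def of_nat_mult[symmetric] by simp
      moreover have "real (Suc m - k) = real m + 1 - real k"
        using km by simp
      ultimately have 2: "real (n choose k) * (real m + 1 - real k) = real (Suc m) * x"
        by (simp add: mult.commute)
      have 3: "real (n choose Suc k) = real (Suc m) * x / real (Suc k)"
        using 1 by (simp add: field_simps)
      have 4: "real (n choose k) = real (Suc m) * x / (real m + 1 - real k)"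
        using 2 km by (simp add: field_simps)
      have nz: "real m + 1 - real k \<noteq> 0" using km by simp
      have "real D / real (Suc n * (n choose Suc k)) = real D * (real k + 1) / ((real m + 2) * ((real m + 1) * x))"
        by (simp only: of_nat_mult 3) (simp add: n field_simps)
      also have "\<dots> = real D / ((real m + 1) * x) - real D * (real m + 1 - real k) / ((real m + 2) * ((real m + 1) * x))"
        using x by (simp add: divide_simps) (simp add: algebra_simps)
      also have "real D * (real m + 1 - real k) / ((real m + 2) * ((real m + 1) * x)) = real D / real (Suc n * (n choose k))"
        using nz by (simp only: of_nat_mult 4) (simp add: n field_simps)
      also have "real D / ((real m + 1) * x) = real D / real (Suc m * (m choose k))"
        by (simp add: x_def algebra_simps)
      finally show ?thesis .
    qed
    ultimately show ?case by simp
  qed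
  then obtain z :: int where "real D / real (Suc n * (n choose k)) = of_int z"
    by (elim Ints_cases)
  moreover have "real (Suc n * (n choose k)) \<noteq> 0"
    unfolding of_nat_eq_0_iff using assms(2) by simp
  ultimately have "real D = of_int z * real (Suc n * (n choose k))"
    by (simp add: field_simps)
  then have "int D = z * int (Suc n * (n choose k))"
    by (metis of_int_eq_iff of_int_mult of_int_of_nat_eq)
  then have "int (Suc n * (n choose k)) dvd int D"
    by simp
  then show ?thesis
    by (simp only: int_dvd_int_iff)
qed

text \<open>The exponent of \<open>p\<close> in an lcm is the largest exponent among the members,
  and some member attains it.\<close>

lemma prime_power_dvd_Lcm:
  fixes A :: "nat set"
  assumes "prime p" "finite A" "0 \<notin> A" "p ^ a dvd Lcm A" "a > 0"
  shows "\<exists>x\<in>A. p ^ a dvd x"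
  using assms(2-4)
proof (induction A rule: finite_induct)
  case empty
  then show ?case using assms(1,5) by simp
next
  case (insert x A)
  have "x \<noteq> 0" "Lcm A \<noteq> 0"
    using insert by (auto simp: Lcm_0_iff)
  then have "a \<le> max (multiplicity p x) (multiplicity p (Lcm A))"
    using insert.prems(2) assms(1)
    by (subst multiplicity_lcm[symmetric]) (auto intro!: multiplicity_geI simp: lcm_pos_nat)
  then have "p ^ a dvd x \<or> p ^ a dvd Lcm A"
    by (auto simp: le_max_iff_disj intro: multiplicity_dvd')
  then show ?case
    using insert by auto
qed

text \<open>For \<open>k >= 1\<close>,
  \<open>k * (n choose k) = n * ((n - 1) choose (k - 1))\<close> divides the lcm of
  \<open>1, ..., n\<close>, and a nontrivial prime power dividing that lcm divides one of these
  numbers. Exponents of factorials are not computed.\<close>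

lemma prime_power_dvd_choose_le:
  assumes "prime p" "p ^ a dvd n choose k" "k \<le> n" "n > 0"
  shows "p ^ a \<le> n"
proof (cases "a = 0 \<or> k = 0")
  case True
  then have "p ^ a dvd 1 \<or> a = 0" using assms(2) by auto
  then show ?thesis using assms(4) by auto
next
  case False
  then obtain l m where l: "k = Suc l" "n = Suc m" using assms by (cases k; cases n) auto
  have "n choose k dvd k * (n choose k)" by simp
  also have "k * (n choose k) = Suc m * (m choose l)"
    using Suc_times_binomial_eq[of m l] l by (simp only: mult.commute)
  also have "\<dots> dvd Lcm {1..n}"
    using assms l by (intro Suc_times_choose_dvd) auto
  finally have "p ^ a dvd Lcm {1..n}"
    using assms(2) dvd_trans by blast
  then obtain x where "x \<in> {1..n}" "p ^ a dvd x"
    using prime_power_dvd_Lcm[OF assms(1), of "{1..n}" a] False by auto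
  then show ?thesis
    using dvd_imp_le[of "p ^ a" x] by auto
qed

section \<open>Bertrand's postulate for large \<open>n\<close> via the central binomial
  coefficient\<close>

text \<open>The only multiples of \<open>p\<close> up to \<open>2 * n\<close> are \<open>p\<close>
  and \<open>2 * p\<close>, so \<open>fact (2 * n)\<close> contains \<open>p\<close> exactly twice,
  and the two factors \<open>fact n\<close> use up both copies.\<close>

lemma central_choose_not_dvd:
  assumes "prime p" "n \<ge> 3" "2 * n < 3 * p" "p \<le> n"
  shows "\<not> p dvd (2 * n) choose n"
proof
  assume "p dvd (2 * n) choose n"
  moreover have "p dvd fact n"
    using assms by (simp add: prime_dvd_fact_iff)
  ultimately have "p * p * p dvd fact n * fact n * ((2 * n) choose n)"
    by (intro mult_dvd_mono)
  also have "\<dots> = fact (2 * n)"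
    using binomial_fact_lemma[of n "2 * n"] by (simp add: mult_2)
  also have "\<dots> = \<Prod>{1..2 * n}"
    by (simp add: fact_prod)
  also have "{1..2 * n} = insert p (insert (2 * p) ({1..2 * n} - {p, 2 * p}))"
    using assms prime_gt_0_nat[OF assms(1)] by auto
  also have "\<Prod>\<dots> = p * (2 * p * \<Prod>({1..2 * n} - {p, 2 * p}))"
    using prime_gt_0_nat[OF assms(1)] by (subst prod.insert; simp)
  finally have "(p * p) * p dvd (p * p) * (2 * \<Prod>({1..2 * n} - {p, 2 * p}))"
    by (simp add: mult_ac)
  then have "p dvd 2 * \<Prod>({1..2 * n} - {p, 2 * p})"
    using prime_gt_0_nat[OF assms(1)] by (simp only: nat_mult_dvd_cancel_disj) simp
  \<comment> \<open>The bounds \<open>n >= 3\<close> and \<open>2 * n < 3 * p\<close> exclude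
    \<open>p = 2\<close>, for which \<open>2 * p\<close> would carry another factor
    \<open>p\<close>.\<close>
  moreover have "\<not> p dvd 2"
    using assms by (auto dest!: dvd_imp_le)
  ultimately have "p dvd \<Prod>({1..2 * n} - {p, 2 * p})"
    using assms(1) prime_dvd_mult_iff by blast
  then obtain x where x: "x \<in> {1..2 * n} - {p, 2 * p}" "p dvd x"
    using prime_dvd_prod_iff[of "{1..2 * n} - {p, 2 * p}" p "\<lambda>x. x"] assms(1) by blast
  then obtain c where c: "x = p * c" by blast
  have "x \<le> 2 * n" using x by simp
  then have "p * c < p * 3" using c assms(3) by linarith
  then have "c < 3" by simp
  then have "c = 0 \<or> c = 1 \<or> c = 2" by linarith
  then show False using x c by auto
qed

text \<open>All prime factors are then at most \<open>2 * n / 3\<close>. Those up to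
  \<open>sqrt (2 * n)\<close> contribute at most \<open>2 * n\<close> each; the larger ones occur to
  the first power and are bounded by the primorial.\<close>

lemma central_choose_le_if_no_prime:
  assumes "n \<ge> 3" "\<And>p. prime p \<Longrightarrow> n < p \<Longrightarrow> p \<le> 2 * n \<Longrightarrow> False"
  shows "(2 * n) choose n \<le> (2 * n) ^ nat \<lfloor>sqrt (2 * n)\<rfloor> * 4 ^ (2 * n div 3)"
proof -
  define C where "C = (2 * n) choose n"
  define s where "s = nat \<lfloor>sqrt (2 * n)\<rfloor>"
  have C: "C > 0" by (simp add: C_def)
  have le: "p ^ multiplicity p C \<le> 2 * n" if "prime p" for p
    using assms(1) unfolding C_def
    by (intro prime_power_dvd_choose_le[OF that multiplicity_dvd]) auto
  have small: "prime p \<and> p \<le> 2 * n div 3" if "p \<in> prime_factors C" for p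
  proof -
    have p: "prime p" "p dvd C" using that by auto
    have "p \<le> 2 * n"
      using prime_power_dvd_choose_le[of p 1 "2 * n" n] p assms(1) by (simp add: C_def)
    then have "p \<le> n"
      using assms(2)[of p] p(1) not_less by blast
    then have "\<not> 2 * n < 3 * p"
      using central_choose_not_dvd[of p n] p assms(1) by (auto simp: C_def)
    then show ?thesis using p(1) by simp
  qed
  have "C = (\<Prod>p\<in>prime_factors C. p ^ multiplicity p C)"
    using prod_prime_factors[of C] C by simp
  \<comment> \<open>The factor \<open>p\<close> is kept also for \<open>p <= s\<close>, so that the
    product over all primes up to \<open>2 * n div 3\<close> splits off the whole primorial.\<close>
  also have "\<dots> \<le> (\<Prod>p\<in>prime_factors C. (if p \<le> s then 2 * n else 1) * p)"
  proof (intro prod_mono conjI)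
    fix p assume "p \<in> prime_factors C"
    then have p: "prime p" by auto
    show "p ^ multiplicity p C \<le> (if p \<le> s then 2 * n else 1) * p"
    proof (cases "p \<le> s")
      case True
      have "p ^ multiplicity p C \<le> 2 * n * 1" using le[OF p] by simp
      also have "\<dots> \<le> 2 * n * p" using prime_gt_0_nat[OF p] by (intro mult_left_mono) auto
      finally show ?thesis using True by simp
    next
      case False
      have "multiplicity p C \<le> 1"
      proof (rule ccontr)
        assume "\<not> ?thesis"
        then have "p ^ 2 \<le> p ^ multiplicity p C"
          using prime_gt_0_nat[OF p] by (intro power_increasing) auto
        then have "p ^ 2 \<le> 2 * n" using le[OF p] by simp
        then have "real p \<le> sqrt (2 * n)"
          by (intro real_le_rsqrt) (metis of_nat_le_iff of_nat_power)
        then have "p \<le> s" unfolding s_def by (rule le_nat_floor)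
        then show False using False by simp
      qed
      then have "p ^ multiplicity p C \<le> p ^ 1"
        using prime_gt_0_nat[OF p] by (intro power_increasing) auto
      then show ?thesis using False by simp
    qed
  qed auto
  also have "\<dots> \<le> (\<Prod>p | prime p \<and> p \<le> 2 * n div 3. (if p \<le> s then 2 * n else 1) * p)"
  proof (rule dvd_imp_le)
    show "(\<Prod>p\<in>prime_factors C. (if p \<le> s then 2 * n else 1) * p)
        dvd (\<Prod>p | prime p \<and> p \<le> 2 * n div 3. (if p \<le> s then 2 * n else 1) * p)"
      using small by (intro prod_dvd_prod_subset) auto
    show "0 < (\<Prod>p | prime p \<and> p \<le> 2 * n div 3. (if p \<le> s then 2 * n else 1) * p)"
      using assms(1) prime_gt_0_nat by (intro prod_pos) auto
  qed
  also have "\<dots> = (2 * n) ^ card {p. prime p \<and> p \<le> 2 * n div 3 \<and> p \<le> s} * \<Prod>{p. prime p \<and> p \<le> 2 * n div 3}"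
    by (simp add: prod.distrib prod.If_cases Int_def conj_assoc)
  also have "\<dots> \<le> (2 * n) ^ s * 4 ^ (2 * n div 3)"
  proof (rule mult_mono)
    have "card {p. prime p \<and> p \<le> 2 * n div 3 \<and> p \<le> s} \<le> card {1..s}"
      by (intro card_mono) (auto dest: prime_gt_0_nat)
    then show "(2 * n) ^ card {p. prime p \<and> p \<le> 2 * n div 3 \<and> p \<le> s} \<le> (2 * n) ^ s"
      using assms(1) by (intro power_increasing) auto
  qed (use primorial_le in auto)
  finally show ?thesis by (simp add: C_def s_def)
qed

text \<open>Otherwise the lower bound \<open>4 ^ n / (2 * n)\<close> for the central binomial
  coefficient would give \<open>n / 3 * ln 4 <= (sqrt (2 * n) + 1) * ln (2 * n)\<close>, which fails
  for large \<open>n\<close>.\<close>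

lemma eventually_prime_between:
  "eventually (\<lambda>n. \<exists>p. prime p \<and> n < p \<and> p \<le> 2 * n) sequentially"
proof -
  have "eventually (\<lambda>n::nat. (sqrt (2 * real n) + 1) * ln (2 * real n) < real n / 3 * ln 4) sequentially"
    by real_asymp
  then show ?thesis
    using eventually_ge_at_top[of "3::nat"]
  proof eventually_elim
    case (elim n)
    show ?case
    proof (rule ccontr)
      assume not: "\<not> ?case"
      define s where "s = nat \<lfloor>sqrt (2 * n)\<rfloor>"
      have "4 ^ n / (2 * real n) \<le> real ((2 * n) choose n)"
        using elim by (intro central_binomial_lower_bound) auto
      also have "\<dots> \<le> real ((2 * n) ^ s * 4 ^ (2 * n div 3))"
        unfolding s_def of_nat_le_iff using not elim by (intro central_choose_le_if_no_prime) auto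
      finally have "4 ^ n \<le> (2 * real n) ^ Suc s * 4 ^ (2 * n div 3)"
        using elim by (simp add: field_simps)
      then have "ln (4 ^ n) \<le> ln ((2 * real n) ^ Suc s * 4 ^ (2 * n div 3))"
        using elim by (subst ln_le_cancel_iff) auto
      also have "\<dots> = ln ((2 * real n) ^ Suc s) + ln (4 ^ (2 * n div 3))"
        using elim by (intro ln_mult_pos) auto
      finally have "real n * ln 4 \<le> real (Suc s) * ln (2 * real n) + real (2 * n div 3) * ln 4"
        using elim by (simp only: ln_realpow)
      also have "\<dots> \<le> (sqrt (2 * real n) + 1) * ln (2 * real n) + (2 * real n / 3) * ln 4"
      proof (intro add_mono mult_right_mono)
        have "real s \<le> sqrt (2 * n)" unfolding s_def by simp
        then show "real (Suc s) \<le> sqrt (2 * real n) + 1" by simp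
        show "real (2 * n div 3) \<le> 2 * real n / 3" by linarith
      qed (use elim in auto)
      finally show False using elim by (simp add: algebra_simps)
    qed
  qed
qed

section \<open>Digits of symmetric progressions\<close>

lemma same_third:
  fixes a b p :: int
  assumes "p > 0" "3 * a div p = 3 * b div p"
  shows "3 * \<bar>a - b\<bar> < p"
proof -
  define r s where "r = 3 * a mod p" and "s = 3 * b mod p"
  have "3 * a - 3 * b = r - s"
    unfolding r_def s_def minus_mult_div_eq_mod[symmetric] assms(2) by simp
  moreover have "0 \<le> r" "r < p" "0 \<le> s" "s < p"
    using assms(1) by (simp_all add: r_def s_def)
  ultimately show ?thesis by (auto simp: abs_if)
qed

lemma third_less:
  fixes x p :: int
  assumes "p > 0" "x < p"
  shows "3 * x div p < 3"
proof -
  have "p * (3 * x div p) \<le> 3 * x"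
    using assms(1) by (simp flip: minus_mod_eq_mult_div)
  also have "\<dots> < p * 3"
    using assms(2) by simp
  finally show ?thesis
    using assms(1) by simp
qed

text \<open>Prepares the common third for linear arithmetic, free of division.\<close>

lemma third_cases:
  fixes x y p :: int
  assumes "p > 0" "0 \<le> x" "x < p" "3 * x div p = 3 * y div p"
  shows "3 * x < p \<and> 3 * y < p
    \<or> p \<le> 3 * x \<and> 3 * x < 2 * p \<and> p \<le> 3 * y \<and> 3 * y < 2 * p
    \<or> 2 * p \<le> 3 * x \<and> 2 * p \<le> 3 * y"
proof -
  define q r s where "q = 3 * x div p" and "r = 3 * x mod p" and "s = 3 * y mod p"
  have eq: "p * q + r = 3 * x" "p * q + s = 3 * y" and rs: "0 \<le> r" "r < p" "0 \<le> s" "s < p"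
    using assms(1) by (simp_all add: q_def r_def s_def) (simp add: assms(4))
  have "q < 3"
    unfolding q_def using assms(1,3) by (rule third_less)
  moreover have "0 \<le> q"
    using assms(1,2) by (simp add: q_def pos_imp_zdiv_nonneg_iff)
  ultimately have "q = 0 \<or> q = 1 \<or> q = 2" by linarith
  then show ?thesis
    using eq rs by auto
qed

lemma carry_cases:
  fixes e p :: int
  assumes "- 2 * p < p * e" "p * e < 2 * p"
  shows "p * e = - p \<or> p * e = 0 \<or> p * e = p"
proof -
  have "p * (- 2) < p * e" "p * e < p * 2"
    using assms by linarith+
  moreover from this have "p > 0" by linarith
  ultimately have "- 2 < e" "e < 2"
    using mult_less_cancel_left_pos by blast+
  then have "e = - 1 \<or> e = 0 \<or> e = 1" by linarith
  then show ?thesis by auto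
qed

text \<open>\<open>w, v\<close> is the middle pair, \<open>w', v'\<close> the next one, and
  \<open>e, e'\<close> are the carries. As \<open>3 * \<bar>\<delta>\<bar> < p\<close>, a term can
  wrap only if the middle pair lies in an outer third. The wrapped term then lands in the opposite
  outer third, which its partner, moving by less than \<open>p / 3\<close>, cannot reach.\<close>

lemma no_carry_inner:
  fixes v w v' w' \<delta> e e' p :: int
  assumes p: "p > 0"
    and range: "0 \<le> v" "v < p" "0 \<le> w" "w < p" "0 \<le> v'" "v' < p" "0 \<le> w'" "w' < p"
    and inner: "v = w + \<delta>" "3 * w div p = 3 * v div p"
    and outer: "v' = v + \<delta> + p * e" "w' = w - \<delta> + p * e'" "3 * w' div p = 3 * v' div p"
  shows "e = 0 \<and> e' = 0"
proof -
  have \<delta>: "3 * \<bar>\<delta>\<bar> < p"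
    using same_third[OF p inner(2)] inner(1) by simp
  have e: "p * e = - p \<or> p * e = 0 \<or> p * e = p" "p * e' = - p \<or> p * e' = 0 \<or> p * e' = p"
    using \<delta> range outer(1,2) by (intro carry_cases; linarith)+
  have "p * e = 0" "p * e' = 0"
    using e third_cases[OF p range(3,4) inner(2)] third_cases[OF p range(7,8) outer(3)]
      inner(1) outer(1,2) range p
    by (elim disjE conjE; linarith)+
  then show ?thesis using p by simp
qed

text \<open>Later pairs have \<open>v - w = (2 * r + 1) * \<delta>\<close> with
  \<open>r >= 1\<close>, whence the factor 3 and \<open>9 * \<bar>\<delta>\<bar> < p\<close>. A wrap
  of one term, or of both at opposite ends, would push \<open>v' - w'\<close> beyond
  \<open>p / 3\<close>; both cannot wrap at the same end because their steps are opposite.\<close>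

lemma no_carry_outer:
  fixes v w v' w' \<delta> e e' p :: int
  assumes p: "p > 0"
    and range: "0 \<le> v" "v < p" "0 \<le> w" "w < p" "0 \<le> v'" "v' < p" "0 \<le> w'" "w' < p"
    and inner: "3 * \<bar>\<delta>\<bar> \<le> \<bar>v - w\<bar>" "3 * w div p = 3 * v div p"
    and outer: "v' = v + \<delta> + p * e" "w' = w - \<delta> + p * e'" "3 * w' div p = 3 * v' div p"
  shows "e = 0 \<and> e' = 0"
proof -
  have close: "3 * (v - w) < p" "3 * (w - v) < p" "3 * (v' - w') < p" "3 * (w' - v') < p"
    using same_third[OF p inner(2)] same_third[OF p outer(3)] by (auto simp: abs_if split: if_splits)
  moreover have "3 * \<bar>\<delta>\<bar> \<le> v - w \<or> 3 * \<bar>\<delta>\<bar> \<le> w - v"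
    using inner(1) by (auto simp: abs_if split: if_splits)
  ultimately have \<delta>: "9 * \<delta> < p" "- p < 9 * \<delta>"
    by (auto simp: abs_if split: if_splits)
  define E E' where "E = p * e" and "E' = p * e'"
  note outer' = outer(1,2)[folded E_def E'_def]
  have "E = - p \<or> E = 0 \<or> E = p" "E' = - p \<or> E' = 0 \<or> E' = p"
    using range outer' \<delta> unfolding E_def E'_def by (intro carry_cases; linarith)+
  then have "E = 0" "E' = 0"
    using close \<delta> outer' range p by (elim disjE; simp)+
  then show ?thesis using p by (simp add: E_def E'_def)
qed

text \<open>Working outwards from the two middle terms: every pair of terms with digits in a common
  third of \<open>[0, p)\<close> forces the next pair to be reached without carry.\<close>

lemma mod_progression:
  fixes y D p :: int
  assumes p: "p > 0" and k: "even k" "k \<ge> 4"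
    and sym: "\<And>i. i < k \<Longrightarrow> 3 * ((y + int i * D) mod p) div p = 3 * ((y + int (k - 1 - i) * D) mod p) div p"
  shows "\<exists>b \<delta>. \<forall>i<k. (y + int i * D) mod p = b + int i * \<delta>"
proof -
  obtain h where h: "k = 2 * h" "h \<ge> 2" using k by (auto elim!: evenE)
  define u where "u i = (y + int i * D) mod p" for i
  have range: "0 \<le> u i" "u i < p" for i using p by (simp_all add: u_def)
  \<comment> \<open>\<open>v r\<close> and \<open>w r\<close> lie \<open>r\<close> steps outwards
    from the two middle terms, which have indices \<open>h\<close> and \<open>h - 1\<close>.\<close>
  define v where "v r = u (h + r)" for r
  define w where "w r = u (h - 1 - r)" for r
  define \<delta> where "\<delta> = v 0 - w 0"
  \<comment> \<open>\<open>\<delta>\<close> is the step between the middle residues; it agrees with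
    \<open>D\<close>, and so with every other step, only up to a multiple of
    \<open>p\<close>.\<close>
  have u_Suc: "\<exists>e. u (Suc i) = u i + \<delta> + p * e" for i
  proof -
    have step: "\<exists>e. u (Suc i) - u i = D + p * e" for i
    proof
      show "u (Suc i) - u i = D + p * ((y + int i * D) div p - (y + int (Suc i) * D) div p)"
        unfolding u_def minus_mult_div_eq_mod[symmetric] by (simp add: algebra_simps)
    qed
    obtain e where e: "u (Suc i) - u i = D + p * e" using step by blast
    obtain f where f: "u (Suc (h - 1)) - u (h - 1) = D + p * f" using step by blast
    have "\<delta> = D + p * f" using f h by (simp add: \<delta>_def v_def w_def)
    then have "u (Suc i) = u i + \<delta> + p * (e - f)"
      using e by (simp add: algebra_simps)
    then show ?thesis by blast
  qed
  have third: "3 * w r div p = 3 * v r div p" if "r < h" for r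
  proof -
    have "k - 1 - (h - 1 - r) = h + r" using h that by simp
    then show ?thesis
      using sym[of "h - 1 - r"] that h by (simp add: w_def v_def u_def)
  qed
  have main: "v r = v 0 + int r * \<delta> \<and> w r = w 0 - int r * \<delta>" if "r < h" for r
    using that
  proof (induction r)
    case 0
    then show ?case by simp
  next
    case (Suc r)
    obtain e where e: "v (Suc r) = v r + \<delta> + p * e"
      using u_Suc[of "h + r"] by (auto simp: v_def)
    obtain f where "u (Suc (h - 1 - Suc r)) = u (h - 1 - Suc r) + \<delta> + p * f"
      using u_Suc by blast
    moreover have "Suc (h - 1 - Suc r) = h - 1 - r" using Suc.prems by simp
    ultimately have f: "w (Suc r) = w r - \<delta> + p * (- f)"
      by (simp add: w_def)
    note r = range[of "h + r"] range[of "h - 1 - r"] range[of "h + Suc r"] range[of "h - 1 - Suc r"]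
    have "e = 0 \<and> - f = 0"
    \<comment> \<open>The middle pair differs by \<open>\<delta>\<close> alone, so the size of the
      difference does not suffice and the position of the third is used.\<close>
    proof (cases "r = 0")
      case True
      then show ?thesis
        using no_carry_inner[OF p r[folded v_def w_def] _ _ e f] third[of r] third[of "Suc r"] Suc.prems
        by (simp add: \<delta>_def)
    next
      case False
      have "v r - w r = (2 * int r + 1) * \<delta>"
        using Suc by (simp add: \<delta>_def algebra_simps)
      then have "\<bar>v r - w r\<bar> = (2 * int r + 1) * \<bar>\<delta>\<bar>"
        by (simp add: abs_mult)
      also have "\<dots> \<ge> 3 * \<bar>\<delta>\<bar>"
        using False by (intro mult_right_mono) auto
      finally show ?thesis
        using no_carry_outer[OF p r[folded v_def w_def] _ _ e f] third[of r] third[of "Suc r"] Suc.prems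
        by simp
    qed
    then show ?case
      using Suc e f by (simp add: algebra_simps)
  qed
  have "u i = (v 0 - int h * \<delta>) + int i * \<delta>" if "i < k" for i
  proof (cases "i < h")
    case True
    then have "w (h - 1 - i) = u i" using h by (simp add: w_def)
    moreover have "w (h - 1 - i) = w 0 - int (h - 1 - i) * \<delta>"
      using main[of "h - 1 - i"] h by simp
    moreover have "int (h - 1 - i) = int h - 1 - int i" using True by simp
    ultimately show ?thesis by (simp add: \<delta>_def algebra_simps)
  next
    case False
    then have "v (i - h) = u i" by (simp add: v_def)
    moreover have "v (i - h) = v 0 + int (i - h) * \<delta>"
      using main[of "i - h"] h that by simp
    moreover have "int (i - h) = int i - int h" using False by simp
    ultimately show ?thesis by (simp add: algebra_simps)
  qed
  then show ?thesis unfolding u_def by blast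
qed

definition digit :: "int \<Rightarrow> nat \<Rightarrow> int \<Rightarrow> int" where
  "digit p l x = x div p ^ l mod p"

lemma digit_range: "p > 0 \<Longrightarrow> 0 \<le> digit p l x" "p > 0 \<Longrightarrow> digit p l x < p"
  by (simp_all add: digit_def)

lemma eq_if_digits_eq:
  assumes "p > 0" "\<And>l. l < m \<Longrightarrow> digit p l x = digit p l y" "x \<in> {0..<p ^ m}" "y \<in> {0..<p ^ m}"
  shows "x = y"
proof -
  have "x mod p ^ m = y mod p ^ m"
    using assms(2)
  proof (induction m)
    case (Suc m)
    have "z mod p ^ Suc m = p ^ m * digit p m z + z mod p ^ m" for z
      using zmod_zmult2_eq[of p z "p ^ m"] assms(1) by (simp add: digit_def mult.commute)
    then show ?case using Suc by simp
  qed simp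
  then show ?thesis using assms(3,4) by simp
qed

text \<open>Induction on \<open>l\<close>: when the quotients by \<open>p ^ l\<close> and their last
  digits are progressions, subtracting and dividing by \<open>p\<close> gives the next quotients.
  For the leading digit \<open>l = m\<close>, where no thirds are compared, the quotient itself is
  the digit.\<close>

lemma digits_progression:
  assumes p: "p > 0" and k: "even k" "k \<ge> 4"
    and range: "\<And>i. i < k \<Longrightarrow> a + int i * d \<in> {0..<p ^ Suc m}"
    and sym: "\<And>i l. i < k \<Longrightarrow> l < m \<Longrightarrow>
      3 * digit p l (a + int i * d) div p = 3 * digit p l (a + int (k - 1 - i) * d) div p"
    and "l \<le> m"
  shows "\<exists>b \<delta>. \<forall>i<k. digit p l (a + int i * d) = b + int i * \<delta>"
proof -
  have quot: "\<exists>Y D. \<forall>i<k. (a + int i * d) div p ^ l = Y + int i * D" if "l \<le> m" for l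
    using that
  proof (induction l)
    case 0
    show ?case by auto
  next
    case (Suc l)
    then obtain Y D where Y: "\<And>i. i < k \<Longrightarrow> (a + int i * d) div p ^ l = Y + int i * D"
      by auto
    have "3 * ((Y + int i * D) mod p) div p = 3 * ((Y + int (k - 1 - i) * D) mod p) div p" if "i < k" for i
      using sym[OF that, of l] Y[OF that] Y[of "k - 1 - i"] that Suc.prems by (simp add: digit_def)
    then obtain b \<delta> where b: "\<And>i. i < k \<Longrightarrow> (Y + int i * D) mod p = b + int i * \<delta>"
      using mod_progression[OF p k] by blast
    define z where "z i = (a + int i * d) div p ^ Suc l" for i
    have pz: "p * z i = (Y - b) + int i * (D - \<delta>)" if "i < k" for i
    proof -
      have "z i = (Y + int i * D) div p"
        using zdiv_zmult2_eq[of p "a + int i * d" "p ^ l"] p Y[OF that]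
        by (simp add: z_def mult.commute)
      then have "p * z i = (Y + int i * D) - (Y + int i * D) mod p"
        by (simp add: minus_mod_eq_mult_div)
      then show ?thesis
        using b[OF that] by (simp add: algebra_simps)
    qed
    have pz0: "p * z 0 = Y - b" and pz1: "p * z 1 = Y - b + (D - \<delta>)"
      using pz[of 0] pz[of 1] k by simp_all
    \<comment> \<open>Offset and step are read off from \<open>z 0\<close> and \<open>z 1\<close>,
      and the identity is checked after multiplication by \<open>p\<close>; this replaces a proof
      that \<open>p\<close> divides \<open>Y - b\<close> and \<open>D - \<delta>\<close>.\<close>
    have "z i = z 0 + int i * (z 1 - z 0)" if "i < k" for i
    proof -
      have eq: "p * (z 0 + int i * (z 1 - z 0)) = p * z 0 + int i * (p * z 1 - p * z 0)"
        by (simp add: algebra_simps)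
      have "p * z i = p * (z 0 + int i * (z 1 - z 0))"
        unfolding eq pz0 pz1 using pz[OF that] by simp
      then show ?thesis using p by simp
    qed
    then show ?case unfolding z_def by blast
  qed
  show ?thesis
  proof (cases "l = m")
    case True
    have "digit p l (a + int i * d) = (a + int i * d) div p ^ l" if "i < k" for i
    proof -
      have "a + int i * d < p * p ^ m" "0 \<le> a + int i * d" using range[OF that] by auto
      moreover have "p ^ m * ((a + int i * d) div p ^ m) \<le> a + int i * d"
        using p by (simp flip: minus_mod_eq_mult_div)
      ultimately have "p ^ m * ((a + int i * d) div p ^ m) < p ^ m * p"
        by (simp add: mult.commute)
      then have "(a + int i * d) div p ^ m < p"
        using p by (simp add: mult_less_cancel_left_pos)
      moreover have "0 \<le> (a + int i * d) div p ^ m"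
        using p \<open>0 \<le> a + int i * d\<close> by (simp add: pos_imp_zdiv_nonneg_iff)
      ultimately show ?thesis unfolding digit_def True by simp
    qed
    then show ?thesis using quot[of l] True by simp
  next
    case False
    then have l: "l < m" using assms(6) by simp
    obtain Y D where Y: "\<And>i. i < k \<Longrightarrow> (a + int i * d) div p ^ l = Y + int i * D"
      using quot[of l] l by auto
    have "3 * ((Y + int i * D) mod p) div p = 3 * ((Y + int (k - 1 - i) * D) mod p) div p" if "i < k" for i
      using sym[OF that l] Y[OF that] Y[of "k - 1 - i"] that by (simp add: digit_def)
    then show ?thesis
      using mod_progression[OF p k] Y by (simp add: digit_def)
  qed
qed

section \<open>The coloring\<close>

text \<open>Block \<open>r\<close> starts at index \<open>r ^ 2 = 1 + 3 + ... + (2 * r - 1)\<close>,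
  the total length of the blocks before it.\<close>

lemma square_blocks:
  fixes l h :: nat
  assumes "l < h\<^sup>2"
  obtains r l' where "r < h" "l' < 2 * r + 1" "l = r\<^sup>2 + l'"
  using assms
proof (induction h arbitrary: thesis)
  case (Suc h)
  show ?case
  proof (cases "l < h\<^sup>2")
    case True
    then show ?thesis using Suc.IH Suc.prems(1) less_SucI by metis
  next
    case False
    then have "l - h\<^sup>2 < 2 * h + 1" "l = h\<^sup>2 + (l - h\<^sup>2)"
      using Suc.prems(2) by (auto simp: power2_eq_square)
    then show ?thesis using Suc.prems(1)[of h "l - h\<^sup>2"] by simp
  qed
qed simp

lemma block_index_less:
  fixes r l h :: nat
  assumes "r < h" "l < 2 * r + 1"
  shows "r\<^sup>2 + l < h\<^sup>2"
proof -
  have "r\<^sup>2 + l < (r + 1)\<^sup>2" using assms(2) by (simp add: power2_eq_square)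
  also have "\<dots> \<le> h\<^sup>2" using assms(1) by (intro power_mono) auto
  finally show ?thesis .
qed

text \<open>Meant for \<open>n\<close>-th differences \<open>x\<close>, \<open>y\<close> of a
  function and its reversal, with leading terms \<open>a\<close>, \<open>b\<close> of opposite sign
  modulo \<open>q\<close>.\<close>

lemma dvd_double:
  fixes a b x y q :: int
  assumes "q dvd x - y" "q dvd x - a" "q dvd y - b" "q dvd a + b"
  shows "q dvd 2 * a"
proof -
  have "q dvd (a + b) - (x - a) + (x - y) + (y - b)"
    by (rule dvd_add[OF dvd_add[OF dvd_diff[OF assms(4,2)] assms(1)] assms(3)])
  then show ?thesis by simp
qed

lemma exists_coloring:
  assumes p: "prime p" and k: "k = 2 * h" "h \<ge> 2" "k \<le> p" and N: "N < p ^ h\<^sup>2"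
  shows "\<exists>c :: int \<Rightarrow> nat. card (c ` {1..int N}) \<le> p * 3 ^ (h\<^sup>2 - 1) \<and> no_symmetric_ap c N k"
proof -
  have "\<forall>r. \<exists>g. anisotropic_form p (2 * r + 1) g"
    using exists_anisotropic_form[OF p] by simp
  then obtain g where g: "\<And>r. anisotropic_form p (2 * r + 1) (g r)"
    by metis
  have local: "g r v = g r w" if "\<And>l. l < 2 * r + 1 \<Longrightarrow> v l = w l" for r v w
    using g[of r] that unfolding anisotropic_form_def by blast
  have aniso: "int p dvd v l" if "int p dvd g r v" "l < 2 * r + 1" for r v l
    using g[of r] that unfolding anisotropic_form_def by blast
  have odd: "int p dvd g r v + g r (\<lambda>l. - v l)" for r v
    using g[of r] unfolding anisotropic_form_def by simp
  have diff: "int p dvd (\<Sum>i\<le>n. (-1) ^ i * int (n choose i) * g r (\<lambda>l. s l + int i * v l))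
      - (if n = 2 * r + 1 then (-1) ^ n * int (fact n) * g r v else 0)" if "n \<ge> 2 * r + 1" for r s v n
    using g[of r] that unfolding anisotropic_form_def by blast
  define m where "m = h\<^sup>2"
  define G where "G v = (\<Sum>r<h. g r (\<lambda>l. v (r\<^sup>2 + l)))" for v
  have p0: "int p > 0" using p prime_gt_0_nat by simp
  have G_cong: "G v = G w" if "\<And>l. l < m \<Longrightarrow> v l = w l" for v w
    unfolding G_def using that block_index_less by (intro sum.cong local) (auto simp: m_def)
  \<comment> \<open>When the blocks above \<open>r\<close> do not move, the
    \<open>(2 * r + 1)\<close>-th difference of \<open>G\<close> isolates the form of block
    \<open>r\<close>: lower blocks have smaller degree, higher ones are constant.\<close>
  have top: "int p dvd (\<Sum>i\<le>2 * r + 1. (-1) ^ i * int ((2 * r + 1) choose i) * G (\<lambda>l. s l + int i * v l))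
      - (-1) ^ (2 * r + 1) * int (fact (2 * r + 1)) * g r (\<lambda>l. v (r\<^sup>2 + l))"
    if r: "r < h" and zero: "\<And>r' l. r < r' \<Longrightarrow> r' < h \<Longrightarrow> l < 2 * r' + 1 \<Longrightarrow> v (r'\<^sup>2 + l) = 0"
    for r s v
  proof -
    define n where "n = 2 * r + 1"
    define S where "S r' = (\<Sum>i\<le>n. (-1) ^ i * int (n choose i) * g r' (\<lambda>l. s (r'\<^sup>2 + l) + int i * v (r'\<^sup>2 + l)))" for r'
    define T where "T r' = (if r' = r then (-1) ^ n * int (fact n) * g r (\<lambda>l. v (r\<^sup>2 + l)) else 0)" for r'
    have "(\<Sum>i\<le>n. (-1) ^ i * int (n choose i) * G (\<lambda>l. s l + int i * v l)) = (\<Sum>r'<h. S r')"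
      unfolding G_def S_def sum_distrib_left by (rule sum.swap)
    moreover have "(-1) ^ n * int (fact n) * g r (\<lambda>l. v (r\<^sup>2 + l)) = (\<Sum>r'<h. T r')"
      using r by (simp add: T_def)
    moreover have "int p dvd (\<Sum>r'<h. S r' - T r')"
    proof (rule dvd_sum)
      fix r' assume "r' \<in> {..<h}"
      then have r': "r' < h" by simp
      show "int p dvd S r' - T r'"
      proof (cases "r' \<le> r")
        case True
        then show ?thesis
          using diff[of r' n "\<lambda>l. s (r'\<^sup>2 + l)" "\<lambda>l. v (r'\<^sup>2 + l)"]
          by (auto simp: S_def T_def n_def)
      next
        case False
        have "g r' (\<lambda>l. s (r'\<^sup>2 + l) + int i * v (r'\<^sup>2 + l)) = g r' (\<lambda>l. s (r'\<^sup>2 + l))" for i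
          using zero[of r'] False r' by (intro local) simp
        then have "S r' = (\<Sum>i\<le>n. (-1) ^ i * int (n choose i)) * g r' (\<lambda>l. s (r'\<^sup>2 + l))"
          by (simp add: S_def sum_distrib_right)
        also have "(\<Sum>i\<le>n. (-1) ^ i * int (n choose i)) = 0"
          using choose_alternating_sum[of n, where ?'a = int] by (simp add: n_def)
        finally show ?thesis using False by (simp add: T_def)
      qed
    qed
    ultimately show ?thesis
      unfolding n_def[symmetric] by (simp add: sum_subtractf)
  qed
  define f where "f x = nat (G (\<lambda>l. digit (int p) l x) mod int p)" for x
  define cls where "cls l x = nat (3 * digit (int p) l x div int p)" for l x
  \<comment> \<open>The list stops before the leading digit, of index \<open>m - 1\<close>; hence
    the exponent of 3 in the count.\<close>
  define c0 where "c0 x = (f x, map (\<lambda>l. cls l x) [0..<m - 1])" for x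
  have cls_less: "cls l x < 3" for l x
  proof -
    have "3 * digit (int p) l x div int p < 3"
      using digit_range(2)[OF p0] by (intro third_less p0)
    then show ?thesis by (simp add: cls_def)
  qed
  have "c0 ` {1..int N} \<subseteq> {..<p} \<times> {xs. set xs \<subseteq> {..<3} \<and> length xs = m - 1}"
    using cls_less p0 by (auto simp: c0_def f_def nat_less_iff)
  then have "card (c0 ` {1..int N}) \<le> card ({..<p} \<times> {xs. set xs \<subseteq> {..<3::nat} \<and> length xs = m - 1})"
    by (intro card_mono finite_cartesian_product finite_lists_length_eq) auto
  also have "\<dots> = p * 3 ^ (m - 1)"
    by (simp add: card_cartesian_product card_lists_length_eq)
  finally have card0: "card (c0 ` {1..int N}) \<le> p * 3 ^ (m - 1)" .
  define c where "c x = to_nat (c0 x)" for x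
  have "c ` {1..int N} = to_nat ` c0 ` {1..int N}"
    by (auto simp: c_def)
  then have "card (c ` {1..int N}) \<le> p * 3 ^ (m - 1)"
    using card0 card_image_le[of "c0 ` {1..int N}" to_nat] by simp
  moreover have "no_symmetric_ap c N k"
    unfolding no_symmetric_ap_def
  proof clarify
    fix a d assume d: "d \<noteq> 0" and ap: "ap_in_interval N k a d" and sym: "symmetrically_colored c k a d"
    define x where "x i = a + int i * d" for i
    have inner: "c0 (x i) = c0 (x (k - 1 - i))" if "i < h" for i
    proof -
      have "i + 1 \<in> {1..k div 2}" using that k by simp
      then have "c (a + (int (i + 1) - 1) * d) = c (a + (int k - int (i + 1)) * d)"
        using sym unfolding symmetrically_colored_def by blast
      moreover have "int (i + 1) - 1 = int i" "int k - int (i + 1) = int (k - 1 - i)"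
        using that k(1) by simp_all
      ultimately have "to_nat (c0 (x i)) = to_nat (c0 (x (k - 1 - i)))"
        unfolding c_def x_def by (simp only:)
      then show ?thesis by (rule injD[OF inj_to_nat])
    qed
    have sym0: "c0 (x i) = c0 (x (k - 1 - i))" if "i < k" for i
    proof (cases "i < h")
      case False
      then have "k - 1 - i < h" "k - 1 - (k - 1 - i) = i" using that k by auto
      then show ?thesis using inner[of "k - 1 - i"] by simp
    qed (rule inner)
    have range: "x i \<in> {0..<int p ^ m}" if "i < k" for i
    proof -
      have "x i \<in> {1..int N}" using ap that by (auto simp: ap_in_interval_def x_def)
      moreover have "int N < int p ^ m"
        using N unfolding m_def by (metis of_nat_less_iff of_nat_power)
      ultimately show ?thesis
        by (simp only: atLeastLessThan_iff atLeastAtMost_iff) linarith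
    qed
    have m: "m = Suc (m - 1)" using k(2) by (simp add: m_def)
    have "\<forall>l<m. \<exists>b \<delta>. \<forall>i<k. digit (int p) l (x i) = b + int i * \<delta>"
    proof (intro allI impI)
      fix l assume "l < m"
      have "3 * digit (int p) l (x i) div int p = 3 * digit (int p) l (x (k - 1 - i)) div int p"
        if "i < k" "l < m - 1" for i l
      proof -
        have "cls l (x i) = cls l (x (k - 1 - i))"
          using sym0[OF that(1)] that(2) by (simp add: c0_def)
        moreover have "0 \<le> 3 * digit (int p) l y div int p" for y
          using digit_range(1)[OF p0, of l y] p0 by (simp add: pos_imp_zdiv_nonneg_iff)
        ultimately show ?thesis unfolding cls_def by (simp only: eq_nat_nat_iff)
      qed
      then show "\<exists>b \<delta>. \<forall>i<k. digit (int p) l (x i) = b + int i * \<delta>"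
        unfolding x_def using range[unfolded x_def] k \<open>l < m\<close> m
        by (intro digits_progression[OF p0, where m = "m - 1"]) auto
    qed
    then obtain b \<delta> where dig: "\<And>l i. l < m \<Longrightarrow> i < k \<Longrightarrow> digit (int p) l (x i) = b l + int i * \<delta> l"
      by metis
    \<comment> \<open>A digit step is a difference of two digits, so its absolute value is below
      \<open>p\<close> and divisibility by \<open>p\<close> means that it is 0.\<close>
    have small: "\<delta> l = 0" if "l < m" "int p dvd \<delta> l" for l
    proof -
      have "\<delta> l = digit (int p) l (x 1) - digit (int p) l (x 0)"
        using dig[OF that(1), of 0] dig[OF that(1), of 1] k by simp
      then have "\<bar>\<delta> l\<bar> < int p"
        using digit_range[OF p0, of l "x 0"] digit_range[OF p0, of l "x 1"] by linarith
      then show ?thesis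
        using that(2) zdvd_imp_le[of "int p" "\<bar>\<delta> l\<bar>"] by fastforce
    qed
    have blocks: "\<delta> (r\<^sup>2 + l) = 0" if "r < h" "l < 2 * r + 1" for r l
      using that
    \<comment> \<open>The longest block, \<open>r = h - 1\<close>, comes first; each shorter one
      uses that all longer ones are constant.\<close>
    proof (induction "h - r" arbitrary: r l rule: less_induct)
      case less
      have zero: "\<delta> (r'\<^sup>2 + l) = 0" if "r < r'" "r' < h" "l < 2 * r' + 1" for r' l
        using less.hyps[of r' l] that by simp
      define n where "n = 2 * r + 1"
      \<comment> \<open>\<open>n < k\<close> keeps the indices \<open>0, ..., n\<close> inside the
        progression, and \<open>n < p\<close> makes \<open>fact n\<close> invertible modulo
        \<open>p\<close>.\<close>
      have n: "n < k" "n < p" using less.prems k by (auto simp: n_def)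
      define F where "F i = G (\<lambda>l. b l + int i * \<delta> l)" for i
      \<comment> \<open>\<open>F'\<close> runs through the progression backwards, so its direction
        is \<open>- \<delta>\<close> and the form \<open>g r\<close>, being odd modulo
        \<open>p\<close>, changes sign.\<close>
      define F' where "F' i = G (\<lambda>l. (b l + int (k - 1) * \<delta> l) + int i * (- \<delta> l))" for i
      have F: "f (x i) = nat (F i mod int p)" if "i < k" for i
        unfolding f_def F_def using dig that by (intro arg_cong[where f = "\<lambda>t. nat (t mod int p)"] G_cong) auto
      have "int p dvd F i - F' i" if "i \<le> n" for i
      proof -
        have i: "i < k" using that n by simp
        have "int (k - 1 - i) = int (k - 1) - int i" using i by simp
        then have "F (k - 1 - i) = F' i"
          unfolding F_def F'_def by (intro G_cong) (simp only:, simp add: left_diff_distrib)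
        moreover have "f (x i) = f (x (k - 1 - i))"
          using sym0[OF i] by (simp add: c0_def)
        ultimately have "nat (F i mod int p) = nat (F' i mod int p)"
          using F[OF i] F[of "k - 1 - i"] i by simp
        then have "F i mod int p = F' i mod int p"
          using p0 by (subst (asm) eq_nat_nat_iff) simp_all
        then show ?thesis by (simp add: mod_eq_dvd_iff)
      qed
      then have "int p dvd (\<Sum>i\<le>n. (-1) ^ i * int (n choose i) * (F i - F' i))"
        by (intro dvd_sum dvd_mult) auto
      then have *: "int p dvd (\<Sum>i\<le>n. (-1) ^ i * int (n choose i) * F i) - (\<Sum>i\<le>n. (-1) ^ i * int (n choose i) * F' i)"
        by (simp only: right_diff_distrib sum_subtractf)
      define u where "u = (\<lambda>l. \<delta> (r\<^sup>2 + l))"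
      define A where "A = (-1) ^ n * int (fact n)"
      have "int p dvd (\<Sum>i\<le>n. (-1) ^ i * int (n choose i) * F i) - A * g r u"
        unfolding A_def n_def F_def u_def by (rule top[OF less.prems(1), where v = \<delta>]) (rule zero)
      moreover have "int p dvd (\<Sum>i\<le>n. (-1) ^ i * int (n choose i) * F' i) - A * g r (\<lambda>l. - u l)"
        unfolding A_def n_def F'_def u_def
        by (rule top[OF less.prems(1), where v = "\<lambda>l. - \<delta> l"]) (simp add: zero)
      moreover have "int p dvd A * g r u + A * g r (\<lambda>l. - u l)"
        using odd by (simp flip: distrib_left)
      ultimately have "int p dvd 2 * (A * g r u)"
        using dvd_double[OF *] by blast
      then have "int p dvd 2 * A * g r u"
        by (simp only: mult.assoc)
      moreover have "\<not> int p dvd 2 * A"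
      proof -
        have "\<not> p dvd fact n" using n p by (simp add: prime_dvd_fact_iff)
        moreover have "\<not> p dvd 2" using k by (auto dest!: dvd_imp_le)
        ultimately have "\<not> p dvd 2 * fact n" using p prime_dvd_mult_iff by blast
        then have "\<not> int p dvd int (2 * fact n)" by (simp only: int_dvd_int_iff not_False_eq_True)
        moreover have "(-1) ^ n = (-1 :: int)" by (simp add: n_def)
        then have "2 * A = - int (2 * fact n)" by (simp add: A_def)
        ultimately show ?thesis by (simp only: dvd_minus_iff not_False_eq_True)
      qed
      ultimately have "int p dvd g r u"
        using p by (simp add: prime_dvd_mult_iff)
      then have "int p dvd u l"
        using aniso less.prems(2) by blast
      then show ?case
        using small block_index_less[OF less.prems] by (simp add: u_def m_def)
    qed
    have "digit (int p) l (x 0) = digit (int p) l (x 1)" if "l < m" for l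
    proof -
      obtain r l' where "r < h" "l' < 2 * r + 1" "l = r\<^sup>2 + l'"
        using square_blocks[of l h] \<open>l < m\<close> unfolding m_def by blast
      then have "\<delta> l = 0" using blocks by blast
      then show ?thesis using dig[OF that, of 0] dig[OF that, of 1] k by simp
    qed
    then have "x 0 = x 1"
      using eq_if_digits_eq[OF p0, of m] range[of 0] range[of 1] k by simp
    then show False using d by (simp add: x_def)
  qed
  ultimately show ?thesis unfolding m_def by blast
qed

text \<open>Serves the finitely many \<open>N\<close> below the threshold: \<open>nat\<close> is
  injective on positive integers, so the first and last terms get different colors.\<close>

lemma no_symmetric_ap_nat:
  assumes "k \<ge> 2"
  shows "no_symmetric_ap nat N k"
  unfolding no_symmetric_ap_def
proof clarify
  fix a d assume d: "d \<noteq> 0" and ap: "ap_in_interval N k a d" and sym: "symmetrically_colored nat k a d"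
  have "1 \<in> {1..k div 2}" using assms by simp
  then have "nat (a + (int 1 - 1) * d) = nat (a + (int k - int 1) * d)"
    using sym unfolding symmetrically_colored_def by blast
  moreover have "a + int 0 * d \<in> {1..int N}" "a + int (k - 1) * d \<in> {1..int N}"
    using ap[unfolded ap_in_interval_def, rule_format, of 0]
      ap[unfolded ap_in_interval_def, rule_format, of "k - 1"] assms by simp_all
  ultimately have "(int k - 1) * d = 0"
    using assms by (simp add: of_nat_diff eq_nat_nat_iff)
  then show False using d assms by simp
qed

theorem corollary4p3:
  fixes k :: nat
  assumes "even k" and "k \<ge> 4"
  shows "(\<exists>C::real. \<forall>N::nat. N \<ge> 1 \<longrightarrow>
            (\<exists>c :: int \<Rightarrow> nat.
               real (card (c ` {1..int N})) \<le> C * real N powr (4 / (real k)^2) \<and>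
               no_symmetric_ap c N k)) \<and>
         (\<exists>N0::nat. \<forall>N::nat. N \<ge> N0 \<longrightarrow>
            (\<exists>c :: int \<Rightarrow> nat.
               real (card (c ` {1..int N}))
                 \<le> 2 * (real k - 1) powr ((real k)^2 / 4 - 1) * real N powr (4 / (real k)^2) \<and>
               no_symmetric_ap c N k))"
proof -
  obtain h where k: "k = 2 * h" and h: "h \<ge> 2"
    using assms by (auto elim!: evenE)
  define m where "m = h\<^sup>2"
  define K where "K = 2 * (real k - 1) powr ((real k)^2 / 4 - 1)"
  have m: "m \<ge> 1" using h by (simp add: m_def)
  have km: "(real k)^2 = 4 * real m" by (simp add: k m_def power2_eq_square)
  have exp1: "4 / (real k)^2 = 1 / real m" and exp2: "(real k)^2 / 4 - 1 = real (m - 1)"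
    using m by (simp_all add: km of_nat_diff)
  have K: "K = 2 * (real k - 1) ^ (m - 1)"
    unfolding K_def exp2 using assms(2) by (intro arg_cong2[where f = "(*)"] powr_realpow refl) simp
  obtain n0 where n0: "\<And>n::nat. n \<ge> n0 \<Longrightarrow> \<exists>p. prime p \<and> n < p \<and> p \<le> 2 * n"
    using eventually_prime_between unfolding eventually_sequentially by blast
  \<comment> \<open>\<open>N >= N0\<close> makes the \<open>m\<close>-th root of \<open>N\<close> at
    least \<open>max n0 k + 1\<close>, so that \<open>n >= n0\<close> and the prime above
    \<open>n\<close> exceeds \<open>k\<close>.\<close>
  define N0 where "N0 = Suc (max n0 k) ^ m"
  have large: "\<exists>c :: int \<Rightarrow> nat. real (card (c ` {1..int N})) \<le> K * real N powr (4 / (real k)^2) \<and>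
      no_symmetric_ap c N k" if "N \<ge> N0" for N
  proof -
    define x where "x = real N powr (1 / real m)"
    define n where "n = nat \<lfloor>x\<rfloor>"
    have "N0 \<ge> 1" by (simp add: N0_def)
    then have N: "N > 0" using that by simp
    have xm: "x ^ m = real N"
      unfolding x_def using N m by (simp add: powr_power)
    have x0: "x \<ge> 0" by (simp add: x_def)
    have "real (Suc (max n0 k)) ^ m \<le> x ^ m"
      unfolding xm using that by (metis N0_def of_nat_le_iff of_nat_power)
    then have "real (Suc (max n0 k)) \<le> x"
      using m x0 by (subst (asm) power_mono_iff) auto
    then have n: "Suc (max n0 k) \<le> n"
      unfolding n_def by (rule le_nat_floor)
    then have "n \<ge> n0" by simp
    then obtain p where p: "prime p" "n < p" "p \<le> 2 * n"
      using n0 by blast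
    have "x < real n + 1" unfolding n_def using x0 by linarith
    then have xp: "x < real p" using p(2) by linarith
    have "real N < real p ^ m"
      unfolding xm[symmetric] using xp x0 m by (intro power_strict_mono) auto
    then have "N < p ^ h\<^sup>2"
      unfolding m_def by (metis of_nat_less_iff of_nat_power)
    moreover have "k \<le> p" using p(2) n by linarith
    ultimately obtain c :: "int \<Rightarrow> nat" where c: "card (c ` {1..int N}) \<le> p * 3 ^ (m - 1)" "no_symmetric_ap c N k"
      using exists_coloring[OF p(1) k h] unfolding m_def by blast
    have "real (card (c ` {1..int N})) \<le> real p * 3 ^ (m - 1)"
      using c(1) by (metis of_nat_le_iff of_nat_mult of_nat_numeral of_nat_power)
    \<comment> \<open>The factor 2 comes from \<open>p <= 2 * n\<close>, and
      \<open>3 <= k - 1\<close> because \<open>k >= 4\<close>.\<close>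
    also have "\<dots> \<le> (2 * x) * (real k - 1) ^ (m - 1)"
    proof (rule mult_mono)
      have "real n \<le> x" unfolding n_def using x0 by simp
      then show "real p \<le> 2 * x" using p(3) by linarith
      show "3 ^ (m - 1) \<le> (real k - 1) ^ (m - 1)"
        using assms(2) by (intro power_mono) auto
    qed (use x0 in auto)
    also have "\<dots> = K * real N powr (4 / (real k)^2)"
      by (simp add: K exp1 x_def)
    finally show ?thesis using c(2) by blast
  qed
  \<comment> \<open>For \<open>N < N0\<close> the coloring by \<open>nat\<close> has fewer than
    \<open>N0\<close> colors, and the power of \<open>N\<close> is at least 1.\<close>
  have "\<exists>c :: int \<Rightarrow> nat. real (card (c ` {1..int N})) \<le> max K (real N0) * real N powr (4 / (real k)^2) \<and>
      no_symmetric_ap c N k" if "N \<ge> 1" for N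
  proof (cases "N \<ge> N0")
    case True
    have "K * real N powr (4 / (real k)^2) \<le> max K (real N0) * real N powr (4 / (real k)^2)"
      by (intro mult_right_mono) auto
    then show ?thesis using large[OF True] order_trans by blast
  next
    case False
    have "real (card (nat ` {1..int N})) \<le> real (card {1..int N})"
      by (intro of_nat_mono card_image_le) simp
    also have "\<dots> \<le> max K (real N0) * 1"
      using False by simp
    also have "\<dots> \<le> max K (real N0) * real N powr (4 / (real k)^2)"
      using that by (intro mult_left_mono ge_one_powr_ge_zero) (auto simp: le_max_iff_disj)
    finally show ?thesis
      using no_symmetric_ap_nat[of k N] assms(2) by (intro exI[of _ nat]) simp
  qed
  with large show ?thesis
    unfolding K_def by blast
qed

end
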